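(* Let $a,b$ be nonnegative integers and let $p$ be a prime. (1) If $T^{a,b}_n\equiv 0\pmod p$ for some $0\le n<p$, then the asymptotic density of $0$ in the sequence $(M^{a,b}_n\bmod p)_{n\ge0}$ is $1$. (2) Otherwise (that is, if $T^{a,b}_n\not\equiv0\pmod p$ for all $0\le n<p$), for all $p>2$, the asymptotic density of $0$ in $(M^{a,b}_n\bmod p)_{n\ge 0}$ is equal to $$\begin{aligned}D_0=\ &\frac{\left|\{0\le n<p-2 : M^{a,b}_n\equiv0\}\right|}{p}\\&+\frac{2\left|\{0\le m<p-1 : bT^{a,b}_m\equiv T^{a,b}_{p-1}T^{a,b}_{m+1}\}\right|}{(p-1)(p+1)}\\&+\frac{2\left|\{0\le m<p-1 : bT^{a,b}_m\equiv T^{a,b}_{m+1}\}\right|}{(p-1)p(p+1)},\end{aligned}$$ where $n,m$ range over integers and all congruences are modulo $p$. Furthermore, if the residues mod $p$ of $\{T^{a,b}_n : 0\le n\le p-1\}$ generate $\mathbb{F}_p^\times$ as a multiplicative group, then the asymptotic density of any fixed nonzero $k\in\mathbb{F}_p$ in $(M^{a,b}_n\bmod p)_{n\ge0}$ is $\frac{1-D_0}{p-1}$.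
   Context: For a Laurent polynomial $Q(x)$, $\mathrm{ct}[Q(x)]$ denotes its constant term (the coefficient of $x^0$). For nonnegative integers $a,b$ and $n\ge0$: $T^{a,b}_n=\mathrm{ct}\left[(ax^{-1}+b+ax)^n\right]$ (generalized central trinomial coefficients) and $M^{a,b}_n=\mathrm{ct}\left[(ax^{-1}+b+ax)^n(1-x^2)\right]$ (generalized Motzkin numbers). The asymptotic density of a set $S\subseteq\mathbb{N}=\{0,1,2,\dots\}$ is $\lim_{N\to\infty}\frac{|S\cap\{n\in\mathbb{N}: n<N\}|}{N}$; when it exists, it equals $\lim_{N\to\infty}\frac{|S\cap\{n\in\mathbb{N}: n<p^N\}|}{p^N}$. The density of a value $x\in\mathbb{F}_p$ in a sequence $(c_n)$ over $\mathbb{F}_p$ is the asymptotic density of $\{n\in\mathbb{N}: c_n=x\}$.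
   Formalization: Part (2), including the "Furthermore", is proved under the added assumption that p does not divide a; if p divides a but not b, then M_n ≡ b^n is never 0 mod p, while D_0 = 2/p, so the claim as stated fails there. *)

theory Defs
  imports
    Complex_Main
    "HOL-Computational_Algebra.Formal_Laurent_Series"
    "HOL-Number_Theory.Residues"
    "HOL-Algebra.Generated_Groups"
begin

(* Laurent polynomials over the integers are represented inside the ring of formal
   Laurent series, of which they form a subring. *)

definition ct :: "'a::zero fls \<Rightarrow> 'a" where
  "ct f = fls_nth f 0"

definition trinomial :: "nat \<Rightarrow> nat \<Rightarrow> int fls" where
  "trinomial a b = fls_const (int a) * fls_X_inv + fls_const (int b) + fls_const (int a) * fls_X"

definition central_trinomial :: "nat \<Rightarrow> nat \<Rightarrow> nat \<Rightarrow> int" where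
  "central_trinomial a b n = ct (trinomial a b ^ n)"

definition gen_motzkin :: "nat \<Rightarrow> nat \<Rightarrow> nat \<Rightarrow> int" where
  "gen_motzkin a b n = ct (trinomial a b ^ n * (1 - fls_X ^ 2))"

definition has_asymptotic_density :: "nat set \<Rightarrow> real \<Rightarrow> bool" where
  "has_asymptotic_density S d \<longleftrightarrow>
     (\<lambda>N. real (card (S \<inter> {n. n < N})) / real N) \<longlonglongrightarrow> d"

(* The field with p elements is residue_ring (int p), so k is a canonical
   representative, 0 \<le> k < p. *)
definition value_density_mod :: "(nat \<Rightarrow> int) \<Rightarrow> nat \<Rightarrow> int \<Rightarrow> real \<Rightarrow> bool" where
  "value_density_mod c p k d \<longleftrightarrow> has_asymptotic_density {n. c n mod int p = k} d"

(* This is the density of zeros only if p does not divide a: if p divides a but not b,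
   then both sequences are congruent to b ^ n mod p, so there are no zeros, whereas
   D0 a b p = 2 / p for odd p. *)
definition D0 :: "nat \<Rightarrow> nat \<Rightarrow> nat \<Rightarrow> real" where
  "D0 a b p =
     real (card {n. n < p - 2 \<and> [gen_motzkin a b n = 0] (mod int p)}) / real p
   + 2 * real (card {m. m < p - 1 \<and>
         [int b * central_trinomial a b m
            = central_trinomial a b (p - 1) * central_trinomial a b (m + 1)] (mod int p)})
       / ((real p - 1) * (real p + 1))
   + 2 * real (card {m. m < p - 1 \<and>
         [int b * central_trinomial a b m = central_trinomial a b (m + 1)] (mod int p)})
       / ((real p - 1) * real p * (real p + 1))"

end

theory Submission
  imports Defs
begin

text \<open>
  Write \<open>P = a / x + b + a * x\<close> and \<open>L n\<close> for the coefficient of \<open>x\<close> in \<open>P ^ n\<close>. Since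
  \<open>P(x) ^ p \<equiv> P(x ^ p)\<close> modulo \<open>p\<close>, the numbers \<open>T n\<close> satisfy the Lucas congruence
  \<open>T (p * n + m) \<equiv> T n * T m\<close>, and \<open>M (p * n + m)\<close> is a combination of \<open>T n\<close> and \<open>L n\<close>, in which
  \<open>L n\<close> occurs only for the digits \<open>m = p - 2\<close> and \<open>m = p - 1\<close>. As
  \<open>2 * a * L n = T (n + 1) - b * T n\<close>, these two digits lead to sequences
  \<open>\<alpha> * T n + \<beta> * T (n + 1)\<close>. The last digit \<open>p - 1\<close> turns such a sequence into the one with
  \<open>\<alpha> * T (p - 1)\<close> instead of \<open>\<alpha>\<close>, and \<open>T (p - 1) ^ 2 \<equiv> 1\<close>, so that the densities solve a
  system of two linear equations.

  All densities are obtained from one contraction principle: if the sum of a bounded function over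
  \<open>n < q * N\<close> is controlled by fewer than \<open>q\<close> sums over \<open>n < N\<close> of functions of the same finite
  family, up to an error \<open>o(N)\<close>, then all these functions have mean zero. This gives genuine
  asymptotic densities, not just limits along powers of \<open>p\<close>.
\<close>

section \<open>Coefficients of powers of the trinomial\<close>

unbundle fps_syntax

definition trin_coeff :: "nat \<Rightarrow> nat \<Rightarrow> nat \<Rightarrow> int \<Rightarrow> int" where
  "trin_coeff a b n j = (trinomial a b ^ n) $$ j"

lemma nth_trinomial_mult:
  "(trinomial a b * f) $$ j = int a * f $$ (j - 1) + int b * f $$ j + int a * f $$ (j + 1)"
  unfolding trinomial_def distrib_right mult.assoc fls_X_times_conv_shift(1)
    fls_X_inv_times_conv_shift(1)
  by simp

lemma trin_coeff_0: "trin_coeff a b 0 j = (if j = 0 then 1 else 0)"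
  by (simp add: trin_coeff_def)

lemma trin_coeff_Suc:
  "trin_coeff a b (Suc n) j =
     int a * trin_coeff a b n (j - 1) + int b * trin_coeff a b n j + int a * trin_coeff a b n (j + 1)"
  by (simp add: trin_coeff_def nth_trinomial_mult)

text \<open>The trinomial is invariant under exchanging \<open>x\<close> and \<open>1 / x\<close>,
  so the recurrence is symmetric in \<open>j\<close>.\<close>

lemma trin_coeff_uminus: "trin_coeff a b n (- j) = trin_coeff a b n j"
proof (induction n arbitrary: j)
  case (Suc n)
  have "trin_coeff a b n (- j - 1) = trin_coeff a b n (j + 1)"
    "trin_coeff a b n (- j + 1) = trin_coeff a b n (j - 1)"
    using Suc.IH[of "j + 1"] Suc.IH[of "j - 1"] by simp_all
  then show ?case
    by (simp add: trin_coeff_Suc Suc.IH)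
qed (simp add: trin_coeff_0)

lemma trin_coeff_outside: "\<bar>j\<bar> > int n \<Longrightarrow> trin_coeff a b n j = 0"
proof (induction n arbitrary: j)
  case (Suc n)
  have "\<bar>j - 1\<bar> > int n" "\<bar>j\<bar> > int n" "\<bar>j + 1\<bar> > int n"
    using Suc.prems by linarith+
  then show ?case
    by (simp add: trin_coeff_Suc Suc.IH)
qed (simp add: trin_coeff_0)

lemma trin_coeff_top: "trin_coeff a b n (int n) = int a ^ n"
  by (induction n) (simp_all add: trin_coeff_0 trin_coeff_Suc trin_coeff_outside add.commute)

text \<open>A term of degree \<open>n\<close> takes \<open>b\<close> from exactly one of the
  \<open>n + 1\<close> factors and \<open>a * x\<close> from the others. For
  \<open>n = p - 2\<close> this is the coefficient of \<open>P ^ (p - 1)\<close> that reaches into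
  the next block.\<close>

lemma trin_coeff_subtop: "trin_coeff a b (Suc n) (int n) = int (Suc n) * int a ^ n * int b"
proof (induction n)
  case (Suc n)
  show ?case
    using trin_coeff_top[of a b "Suc n"]
    by (subst trin_coeff_Suc) (simp add: Suc.IH trin_coeff_outside algebra_simps)
qed (simp add: trin_coeff_0 trin_coeff_Suc)

text \<open>This is \<open>x * deriv (P ^ Suc n) = Suc n * P ^ n * (x * deriv P)\<close>, compared
  coefficientwise.\<close>

lemma trin_coeff_deriv:
  "j * trin_coeff a b (Suc n) j =
     int (Suc n) * int a * (trin_coeff a b n (j - 1) - trin_coeff a b n (j + 1))"
proof (induction n arbitrary: j)
  case 0
  consider "j = 1" | "j = - 1" | "j - 1 \<noteq> 0" "j + 1 \<noteq> 0" by linarith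
  then show ?case by cases (simp_all add: trin_coeff_0 trin_coeff_Suc)
next
  case (Suc n)
  let ?c = "trin_coeff a b"
  \<comment> \<open>The factor \<open>j\<close> is written as \<open>(j - 1) + 1\<close>,
    \<open>j\<close> and \<open>(j + 1) - 1\<close> on the three summands, so that the induction
    hypothesis applies to each; the last line collects the corrections.\<close>
  have "j * ?c (Suc (Suc n)) j =
      int a * ((j - 1) * ?c (Suc n) (j - 1)) + int b * (j * ?c (Suc n) j)
      + int a * ((j + 1) * ?c (Suc n) (j + 1))
      + int a * (?c (Suc n) (j - 1) - ?c (Suc n) (j + 1))"
    by (subst trin_coeff_Suc) (simp add: algebra_simps)
  also have "\<dots> = int (Suc n) * int a * (?c (Suc n) (j - 1) - ?c (Suc n) (j + 1))
      + int a * (?c (Suc n) (j - 1) - ?c (Suc n) (j + 1))"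
  proof -
    have "?c (Suc n) (j - 1) = int a * ?c n (j - 1 - 1) + int b * ?c n (j - 1) + int a * ?c n j"
      "?c (Suc n) (j + 1) = int a * ?c n j + int b * ?c n (j + 1) + int a * ?c n (j + 1 + 1)"
      by (simp_all add: trin_coeff_Suc)
    moreover have "?c n (j - 1 + 1) = ?c n j" "?c n (j + 1 - 1) = ?c n j"
      by simp_all
    ultimately show ?thesis
      unfolding Suc.IH by (simp only:) (simp add: algebra_simps)
  qed
  finally show ?case
    by (simp add: algebra_simps)
qed

lemma central_trinomial_eq: "central_trinomial a b n = trin_coeff a b n 0"
  by (simp add: central_trinomial_def ct_def trin_coeff_def)

lemma nth_mult_fls_X_power2: "(f * fls_X ^ 2) $$ j = f $$ (j - 2)"
  by (simp add: fls_X_power_times_comm fls_X_power_times_conv_shift)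

lemma gen_motzkin_eq: "gen_motzkin a b n = trin_coeff a b n 0 - trin_coeff a b n 2"
  using trin_coeff_uminus[of a b n 2]
  by (simp add: gen_motzkin_def ct_def trin_coeff_def right_diff_distrib nth_mult_fls_X_power2)

lemma central_trinomial_0: "central_trinomial a b 0 = 1"
  by (simp add: central_trinomial_eq trin_coeff_0)

lemma central_trinomial_1: "central_trinomial a b (Suc 0) = int b"
  by (simp add: central_trinomial_eq trin_coeff_0 trin_coeff_Suc)

lemma central_trinomial_Suc:
  "central_trinomial a b (Suc n) = int b * central_trinomial a b n + 2 * int a * trin_coeff a b n 1"
  using trin_coeff_uminus[of a b n 1] by (simp add: central_trinomial_eq trin_coeff_Suc)

text \<open>The case \<open>j = 1\<close> of the derivative identity. At \<open>Suc n = p\<close>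
  the factor \<open>int (Suc n)\<close> makes the coefficient vanish modulo
  \<open>p\<close>.\<close>

lemma trin_coeff_Suc_1: "trin_coeff a b (Suc n) 1 = int (Suc n) * int a * gen_motzkin a b n"
  using trin_coeff_deriv[of 1 a b n] by (simp add: gen_motzkin_eq)

text \<open>The coefficient at exponent 2 is eliminated through the recurrence for
  \<open>P ^ Suc n\<close> at exponent 1.\<close>

lemma gen_motzkin_via_trin_coeff:
  "int a * gen_motzkin a b n =
     int b * trin_coeff a b n 1 + 2 * int a * central_trinomial a b n - trin_coeff a b (Suc n) 1"
  by (simp add: gen_motzkin_eq central_trinomial_eq trin_coeff_Suc algebra_simps)

text \<open>The classical three-term recurrence; \<open>\<Delta>\<close> is the discriminant of
  \<open>a + b * x + a * x ^ 2\<close>. It comes from eliminating the coefficients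
  \<open>L\<close>.\<close>

lemma central_trinomial_recurrence:
  fixes a b n :: nat
  defines "\<Delta> \<equiv> (int b)\<^sup>2 - 4 * (int a)\<^sup>2"
  shows "int (n + 2) * central_trinomial a b (n + 2) =
     int (2 * n + 3) * int b * central_trinomial a b (n + 1)
     - int (n + 1) * \<Delta> * central_trinomial a b n"
proof -
  let ?T = "central_trinomial a b" and ?L = "\<lambda>n. trin_coeff a b n 1"
  have T1: "?T (n + 1) = int b * ?T n + 2 * int a * ?L n"
    and T2: "?T (n + 2) = int b * ?T (n + 1) + 2 * int a * ?L (n + 1)"
    using central_trinomial_Suc[of a b n] central_trinomial_Suc[of a b "n + 1"] by simp_all
  \<comment> \<open>Both preceding formulas for Motzkin numbers contain the product
    \<open>a * M\<close>, so \<open>M\<close> is eliminated without dividing by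
    \<open>a\<close>.\<close>
  have L: "?L (n + 1) = int (n + 1) * (int b * ?L n + 2 * int a * ?T n - ?L (n + 1))"
    using trin_coeff_Suc_1[of a b n] gen_motzkin_via_trin_coeff[of a b n] by (simp add: mult.assoc)
  have "int (n + 2) * ?T (n + 2) =
      int (n + 2) * int b * ?T (n + 1) + 2 * int a * (int (n + 1) * ?L (n + 1) + ?L (n + 1))"
    unfolding T2 by (simp add: algebra_simps)
  also have "int (n + 1) * ?L (n + 1) + ?L (n + 1) = int (n + 1) * (int b * ?L n + 2 * int a * ?T n)"
    using L unfolding right_diff_distrib by linarith
  also have "2 * int a * (int (n + 1) * (int b * ?L n + 2 * int a * ?T n)) =
      int (n + 1) * (int b * (2 * int a * ?L n) + 4 * (int a)\<^sup>2 * ?T n)"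
    by (simp add: algebra_simps power2_eq_square)
  also have "2 * int a * ?L n = ?T (n + 1) - int b * ?T n"
    using T1 by simp
  finally show ?thesis
    by (simp add: \<Delta>_def algebra_simps power2_eq_square)
qed

section \<open>Reduction modulo a prime\<close>

text \<open>The inner binomial coefficients are divisible by \<open>p\<close>. The ring is arbitrary
  because the lemma is applied to Laurent series.\<close>

lemma power_prime_add_cong:
  fixes x y :: "'a :: comm_ring_1"
  assumes "prime p"
  obtains w where "(x + y) ^ p = x ^ p + y ^ p + of_nat p * w"
proof -
  have p: "p > 0" using assms by (rule prime_gt_0_nat)
  let ?f = "\<lambda>k. of_nat (p choose k) * x ^ k * y ^ (p - k)"
  have "{..p} = {0, p} \<union> {0<..<p}" using p by auto
  then have "(x + y) ^ p = sum ?f {0, p} + sum ?f {0<..<p}"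
    unfolding binomial_ring by (simp only:) (subst sum.union_disjoint, auto)
  also have "sum ?f {0, p} = x ^ p + y ^ p" using p by simp
  also have "sum ?f {0<..<p} =
      of_nat p * (\<Sum>k\<in>{0<..<p}. of_nat ((p choose k) div p) * x ^ k * y ^ (p - k))"
    unfolding sum_distrib_left
  proof (intro sum.cong refl)
    fix k assume "k \<in> {0<..<p}"
    then have "p dvd (p choose k)" using assms by (intro dvd_choose_prime) auto
    then have "(p choose k) = p * ((p choose k) div p)" by simp
    then have "(of_nat (p choose k) :: 'a) = of_nat p * of_nat ((p choose k) div p)"
      by (metis of_nat_mult)
    then show "?f k = of_nat p * (of_nat ((p choose k) div p) * x ^ k * y ^ (p - k))"
      by (simp add: mult.assoc)
  qed
  finally show thesis by (rule that)
qed

lemma power_cong_of_nat: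
  fixes x y :: "'a :: comm_ring_1"
  assumes "of_nat p dvd x - y"
  shows "of_nat p dvd x ^ n - y ^ n"
proof (induction n)
  case (Suc n)
  have "x ^ Suc n - y ^ Suc n = x * (x ^ n - y ^ n) + (x - y) * y ^ n"
    by (simp add: algebra_simps)
  then show ?case using Suc.IH assms by simp
qed simp

section \<open>Frobenius: the congruence between \<open>P(x) ^ p\<close> and
  \<open>P(x ^ p)\<close>\<close>

definition stretched_trinomial :: "nat \<Rightarrow> nat \<Rightarrow> nat \<Rightarrow> int fls" where
  "stretched_trinomial p a b =
     fls_const (int a) * fls_X_inv ^ p + fls_const (int b) + fls_const (int a) * fls_X ^ p"

lemma nth_stretched_trinomial_mult:
  "(stretched_trinomial p a b * f) $$ j =
     int a * f $$ (j - int p) + int b * f $$ j + int a * f $$ (j + int p)"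
  unfolding stretched_trinomial_def distrib_right mult.assoc
    fls_X_power_times_conv_shift(1) fls_X_inv_power_times_conv_shift(1)
  by simp

lemma fls_const_power_prime:
  assumes "prime p"
  shows "of_nat p dvd (fls_const (int a)) ^ p - fls_const (int a)"
proof -
  have "[a ^ p = a] (mod p)"
  proof (cases "p dvd a")
    case True
    then show ?thesis
      using assms by (simp add: cong_def dvd_imp_mod_0 prime_gt_0_nat dvd_trans[OF _ dvd_power])
  next
    case False
    then have "[a * a ^ (p - 1) = a * 1] (mod p)"
      using assms by (intro cong_mult cong_refl fermat_theorem)
    then show ?thesis using prime_gt_0_nat[OF assms] by (simp add: power_eq_if)
  qed
  then have "int p dvd int a ^ p - int a"
    by (metis cong_iff_dvd_diff cong_int_iff of_nat_power)
  then obtain k where "int a ^ p - int a = int p * k" by (elim dvdE)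
  then have "fls_const (int a) ^ p - fls_const (int a) = of_nat p * fls_const k"
    by (metis fls_const_power fls_minus_const fls_of_nat fls_const_mult_const)
  then show ?thesis by simp
qed

lemma trinomial_power_prime:
  assumes "prime p"
  shows "of_nat p dvd trinomial a b ^ p - stretched_trinomial p a b"
proof -
  let ?A = "fls_const (int a)" and ?B = "fls_const (int b)"
  obtain v where v: "trinomial a b ^ p =
      (?A * fls_X_inv + ?B) ^ p + (?A * fls_X) ^ p + of_nat p * v"
    unfolding trinomial_def by (rule power_prime_add_cong[OF assms])
  obtain w where w: "(?A * fls_X_inv + ?B) ^ p = (?A * fls_X_inv) ^ p + ?B ^ p + of_nat p * w"
    by (rule power_prime_add_cong[OF assms])
  have "trinomial a b ^ p - stretched_trinomial p a b =
      (?A ^ p - ?A) * (fls_X_inv ^ p + fls_X ^ p) + (?B ^ p - ?B) + of_nat p * (v + w)"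
    unfolding v w stretched_trinomial_def power_mult_distrib by (simp add: algebra_simps)
  then show ?thesis
    using fls_const_power_prime[OF assms] by simp
qed

text \<open>Multiplication by \<open>P(x ^ p)\<close> shifts exponents by multiples of
  \<open>p\<close> only. On the exponents divisible by \<open>p\<close> it therefore acts as
  \<open>P\<close> does on the compressed series \<open>g\<close>.\<close>

lemma nth_stretched_trinomial_power:
  assumes "\<And>j. g $$ j = f $$ (int p * j)"
  shows "(stretched_trinomial p a b ^ n * f) $$ (int p * i) = (trinomial a b ^ n * g) $$ i"
proof (induction n arbitrary: i)
  case 0
  then show ?case by (simp add: assms)
next
  case (Suc n)
  have "int p * i - int p = int p * (i - 1)" "int p * i + int p = int p * (i + 1)"
    by (simp_all add: algebra_simps)
  then show ?case
    by (simp add: mult.assoc nth_stretched_trinomial_mult nth_trinomial_mult Suc.IH)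
qed

text \<open>Once \<open>P ^ p\<close> is replaced by \<open>P(x ^ p)\<close>, the constant term sees
  \<open>f\<close> only at multiples of \<open>p\<close>. The hypothesis leaves the exponents 0 and
  \<open>p\<close>, so \<open>f\<close> compresses to a linear polynomial. The factor
  \<open>f\<close> will be built from the lowest digit.\<close>

lemma ct_trinomial_power_cong:
  assumes "prime p" and f: "\<And>j. j \<noteq> 0 \<Longrightarrow> j \<noteq> 1 \<Longrightarrow> f $$ (int p * j) = 0"
  shows "[ct (trinomial a b ^ (p * n) * f) =
     central_trinomial a b n * f $$ 0 + trin_coeff a b n 1 * f $$ int p] (mod int p)"
proof -
  define g where "g = fls_const (f $$ 0) + fls_const (f $$ int p) * fls_X"
  have g: "g $$ j = f $$ (int p * j)" for j
    using f[of j] by (cases "j = 0"; cases "j = 1") (auto simp: g_def)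
  have "of_nat p dvd (trinomial a b ^ p) ^ n - stretched_trinomial p a b ^ n"
    by (intro power_cong_of_nat trinomial_power_prime assms)
  then have "of_nat p dvd ((trinomial a b ^ p) ^ n - stretched_trinomial p a b ^ n) * f"
    by simp
  then obtain w where
    "(trinomial a b ^ (p * n) - stretched_trinomial p a b ^ n) * f = of_nat p * w"
    unfolding power_mult by (elim dvdE)
  then have "ct (trinomial a b ^ (p * n) * f) - (stretched_trinomial p a b ^ n * f) $$ 0 =
      int p * w $$ 0"
    by (metis ct_def fls_minus_nth left_diff_distrib fls_of_nat fls_mult_const_nth(1))
  moreover have "(stretched_trinomial p a b ^ n * f) $$ 0 = (trinomial a b ^ n * g) $$ 0"
    using nth_stretched_trinomial_power[OF g, of a b n 0] by simp
  moreover have "(trinomial a b ^ n * g) $$ 0 =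
      central_trinomial a b n * f $$ 0 + trin_coeff a b n 1 * f $$ int p"
  proof -
    have "trinomial a b ^ n * g = fls_const (f $$ 0) * trinomial a b ^ n
        + fls_const (f $$ int p) * (fls_X * trinomial a b ^ n)"
      by (simp add: g_def algebra_simps)
    then show ?thesis
      \<comment> \<open>The factor \<open>x\<close> picks the coefficient of \<open>1 / x\<close> in
        \<open>P ^ n\<close>, which by symmetry is that of \<open>x\<close>.\<close>
      using trin_coeff_uminus[of a b n 1]
      by (simp add: fls_X_times_conv_shift central_trinomial_eq trin_coeff_def)
  qed
  ultimately show ?thesis
    by (simp add: cong_iff_dvd_diff)
qed

text \<open>The shift \<open>d\<close> accounts for factors \<open>1\<close>, \<open>x\<close> and
  \<open>x ^ 2\<close> next to \<open>P ^ m\<close>: none of them brings in a multiple of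
  \<open>p\<close> other than 0 and \<open>p\<close>.\<close>

lemma trin_coeff_multiple_outside:
  assumes "m < p" "p \<ge> 2" "j \<noteq> 0" "j \<noteq> 1" "0 \<le> d" "d \<le> 2"
  shows "trin_coeff a b m (int p * j - d) = 0"
proof (rule trin_coeff_outside)
  consider "j \<le> - 1" | "j \<ge> 2" using assms by linarith
  then show "int m < \<bar>int p * j - d\<bar>"
  proof cases
    case 1
    then show ?thesis using mult_left_mono[of j "-1" "int p"] assms by linarith
  next
    case 2
    then show ?thesis using mult_left_mono[of 2 j "int p"] assms by linarith
  qed
qed

section \<open>Lucas congruences for \<open>T\<close>, \<open>L\<close> and \<open>M\<close>\<close>

context
  fixes a b p m n :: nat
  assumes p: "prime p" and m: "m < p"
begin

lemma central_trinomial_lucas: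
  "[central_trinomial a b (p * n + m) = central_trinomial a b n * central_trinomial a b m] (mod int p)"
proof -
  have "(trinomial a b ^ m) $$ (int p * j) = 0" if "j \<noteq> 0" "j \<noteq> 1" for j
    using trin_coeff_multiple_outside[OF m prime_ge_2_nat[OF p] that, of 0]
    by (simp add: trin_coeff_def)
  from ct_trinomial_power_cong[OF p this, of a b n] show ?thesis
    using m trin_coeff_outside[of m "int p" a b]
    by (simp add: central_trinomial_def power_add ct_def trin_coeff_def)
qed

text \<open>A factor \<open>x\<close> turns the coefficient of \<open>1 / x\<close>, equal to that
  of \<open>x\<close>, into a constant term. The second summand survives only for the last digit
  \<open>m = p - 1\<close>.\<close>

lemma trin_coeff_1_lucas:
  "[trin_coeff a b (p * n + m) 1 =
      central_trinomial a b n * trin_coeff a b m 1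
      + trin_coeff a b n 1 * trin_coeff a b m (int p - 1)] (mod int p)"
proof -
  let ?f = "trinomial a b ^ m * fls_X"
  have nth: "(f * fls_X) $$ j = f $$ (j - 1)" for f :: "int fls" and j
    by (simp add: fls_X_times_comm fls_X_times_conv_shift)
  have f: "?f $$ j = trin_coeff a b m (j - 1)" for j
    by (simp add: nth trin_coeff_def)
  have "?f $$ (int p * j) = 0" if "j \<noteq> 0" "j \<noteq> 1" for j
    unfolding f by (intro trin_coeff_multiple_outside[OF m prime_ge_2_nat[OF p] that]) simp_all
  from ct_trinomial_power_cong[OF p this, of a b n]
  have "[ct (trinomial a b ^ (p * n) * ?f) = central_trinomial a b n * ?f $$ 0
      + trin_coeff a b n 1 * ?f $$ int p] (mod int p)" .
  moreover have "ct (trinomial a b ^ (p * n) * ?f) = trin_coeff a b (p * n + m) 1"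
    using trin_coeff_uminus[of a b "p * n + m" 1]
    by (simp add: ct_def nth trin_coeff_def power_add flip: mult.assoc)
  ultimately show ?thesis
    using trin_coeff_uminus[of a b m 1] by (simp add: f)
qed

lemma gen_motzkin_lucas:
  "[gen_motzkin a b (p * n + m) =
      central_trinomial a b n * gen_motzkin a b m
      - trin_coeff a b n 1 * trin_coeff a b m (int p - 2)] (mod int p)"
proof -
  let ?f = "trinomial a b ^ m * (1 - fls_X ^ 2)"
  have nth: "?f $$ j = trin_coeff a b m j - trin_coeff a b m (j - 2)" for j
    by (simp add: right_diff_distrib nth_mult_fls_X_power2 trin_coeff_def)
  have "?f $$ (int p * j) = 0" if "j \<noteq> 0" "j \<noteq> 1" for j
    unfolding nth using trin_coeff_multiple_outside[OF m prime_ge_2_nat[OF p] that, of 0]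
      trin_coeff_multiple_outside[OF m prime_ge_2_nat[OF p] that, of 2] by simp
  from ct_trinomial_power_cong[OF p this, of a b n]
  have "[ct (trinomial a b ^ (p * n) * ?f) = central_trinomial a b n * ?f $$ 0
      + trin_coeff a b n 1 * ?f $$ int p] (mod int p)" .
  moreover have "?f $$ 0 = gen_motzkin a b m"
    by (simp add: gen_motzkin_def ct_def)
  moreover have "?f $$ int p = - trin_coeff a b m (int p - 2)"
    unfolding nth using m by (simp add: trin_coeff_outside)
  ultimately show ?thesis
    by (simp add: gen_motzkin_def power_add mult.assoc)
qed

end

section \<open>Asymptotic densities and sections\<close>

definition mean_zero :: "(nat \<Rightarrow> real) \<Rightarrow> bool" where
  "mean_zero f \<longleftrightarrow> (\<lambda>N. (\<Sum>n<N. f n) / real N) \<longlonglongrightarrow> 0"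

text \<open>Centring the indicator turns equations between densities into linear relations between
  partial sums, before any limit is known to exist.\<close>

lemma has_asymptotic_density_iff_mean_zero:
  "has_asymptotic_density S d \<longleftrightarrow> mean_zero (\<lambda>n. of_bool (n \<in> S) - d)"
proof -
  have "real (card (S \<inter> {n. n < N})) / real N - d = (\<Sum>n<N. of_bool (n \<in> S) - d) / real N"
    if "N > 0" for N
  proof -
    have "(\<Sum>n<N. of_bool (n \<in> S) :: real) = real (card (S \<inter> {n. n < N}))"
      by (simp add: of_bool_def sum.If_cases lessThan_def Int_commute)
    then show ?thesis
      using that by (simp add: sum_subtractf diff_divide_distrib)
  qed
  then have "(\<lambda>N. real (card (S \<inter> {n. n < N})) / real N - d) \<longlonglongrightarrow> 0 \<longleftrightarrow>
      (\<lambda>N. (\<Sum>n<N. of_bool (n \<in> S) - d) / real N) \<longlonglongrightarrow> 0"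
    by (intro tendsto_cong eventually_mono[OF eventually_gt_at_top[of 0]])
  then show ?thesis
    unfolding has_asymptotic_density_def mean_zero_def by (simp add: LIM_zero_iff)
qed

lemma sum_lessThan_mult:
  fixes f :: "nat \<Rightarrow> 'a :: comm_monoid_add"
  shows "(\<Sum>n<q * N. f n) = (\<Sum>m<q. \<Sum>n<N. f (q * n + m))"
proof -
  have "(\<Sum>n<q * N. f n) = (\<Sum>n<N. sum f {n * q..<n * q + q})"
    by (simp add: sum.nat_group mult.commute)
  also have "\<dots> = (\<Sum>n<N. \<Sum>m<q. f (q * n + m))"
  proof (rule sum.cong[OF refl])
    fix n
    show "sum f {n * q..<n * q + q} = (\<Sum>m<q. f (q * n + m))"
      using sum.shift_bounds_nat_ivl[of f 0 "n * q" q]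
      by (simp add: add.commute mult.commute lessThan_atLeast0)
  qed
  also have "\<dots> = (\<Sum>m<q. \<Sum>n<N. f (q * n + m))"
    by (rule sum.swap)
  finally show ?thesis .
qed

text \<open>An eventual bound \<open>u * N\<close> on all the partial sums improves to
  \<open>(r * u + \<delta>) * N\<close> with \<open>r = (q - 1) / q < 1\<close>, since at most
  \<open>q - 1\<close> sums of length \<open>N / q\<close> remain. Hence the infimum of the eventual
  bounds is 0. Here \<open>J i\<close> indexes the remaining sums and \<open>\<tau>\<close> names
  the function in each.\<close>

lemma mean_zero_contraction:
  fixes f :: "'i \<Rightarrow> nat \<Rightarrow> real" and e :: "'i \<Rightarrow> nat \<Rightarrow> real"
  assumes "finite I"
    and bound: "\<And>i n. i \<in> I \<Longrightarrow> \<bar>f i n\<bar> \<le> B"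
    and contraction: "\<And>i N. i \<in> I \<Longrightarrow>
      \<bar>\<Sum>n<q * N. f i n\<bar> \<le> (\<Sum>j\<in>J i. \<bar>\<Sum>n<N. f (\<tau> i j) n\<bar>) + e i N"
    and card: "\<And>i. i \<in> I \<Longrightarrow> card (J i) < q"
    and \<tau>: "\<And>i j. i \<in> I \<Longrightarrow> j \<in> J i \<Longrightarrow> \<tau> i j \<in> I"
    and e: "\<And>i. i \<in> I \<Longrightarrow> (\<lambda>N. e i N / real N) \<longlonglongrightarrow> 0"
    and "i \<in> I"
  shows "mean_zero (f i)"
proof -
  define S where "S = (\<lambda>i N. \<Sum>n<N. f i n)"
  define good where "good u \<longleftrightarrow> (\<forall>\<^sub>F N in sequentially. \<forall>i\<in>I. \<bar>S i N\<bar> \<le> u * real N)" for u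
  define r where "r = (real q - 1) / real q"
  have q: "q > 0" using card[OF \<open>i \<in> I\<close>] by simp
  have r: "0 \<le> r" "r < 1" using q by (auto simp: r_def field_simps)
  have B: "0 \<le> B" using bound[OF \<open>i \<in> I\<close>, of 0] by linarith
  have S_diff: "\<bar>S i (N + k)\<bar> \<le> \<bar>S i N\<bar> + real k * B" if "i \<in> I" for i N k
  proof (induction k)
    case (Suc k)
    have "S i (N + Suc k) = S i (N + k) + f i (N + k)" by (simp add: S_def)
    then show ?case using Suc.IH bound[OF that, of "N + k"] by (simp add: algebra_simps)
  qed simp
  have good_B: "good B"
    unfolding good_def using S_diff[where N = 0]
    by (intro always_eventually allI ballI) (simp add: S_def mult.commute)
  \<comment> \<open>The length is cut to \<open>q * (N div q)\<close>; the incomplete last block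
    costs at most \<open>q * B\<close>. This cost and the error \<open>e\<close> each take half of
    \<open>\<delta>\<close>.\<close>
  have step: "good (r * u + \<delta>)" if u: "good u" "0 \<le> u" and \<delta>: "\<delta> > 0" for u \<delta>
  proof -
    have "\<forall>\<^sub>F M in sequentially. \<forall>i\<in>I. e i M \<le> \<delta> / 2 * real M"
      unfolding eventually_ball_finite_distrib[OF \<open>finite I\<close>]
    proof
      fix i assume "i \<in> I"
      have "\<forall>\<^sub>F M in sequentially. e i M / real M < \<delta> / 2"
        using order_tendstoD(2)[OF e[OF \<open>i \<in> I\<close>], of "\<delta> / 2"] \<delta> by simp
      with eventually_gt_at_top[of 0] show "\<forall>\<^sub>F M in sequentially. e i M \<le> \<delta> / 2 * real M"
        by eventually_elim (simp add: field_simps)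
    qed
    with u(1) have "\<forall>\<^sub>F M in sequentially.
        \<forall>i\<in>I. \<bar>S i M\<bar> \<le> u * real M \<and> e i M \<le> \<delta> / 2 * real M"
      unfolding good_def by eventually_elim blast
    moreover have "filterlim (\<lambda>N. N div q) sequentially sequentially"
      unfolding filterlim_at_top
    proof
      fix Z
      show "\<forall>\<^sub>F N in sequentially. Z \<le> N div q"
        using eventually_ge_at_top[of "Z * q"]
        by eventually_elim (use q in \<open>simp add: less_eq_div_iff_mult_less_eq\<close>)
    qed
    ultimately have ev: "\<forall>\<^sub>F N in sequentially. \<forall>i\<in>I.
        \<bar>S i (N div q)\<bar> \<le> u * real (N div q) \<and> e i (N div q) \<le> \<delta> / 2 * real (N div q)"
      by (rule eventually_compose_filterlim)
    obtain N0 :: nat where "2 * real q * B / \<delta> \<le> real N0"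
      using real_arch_simple by blast
    then have "real q * B \<le> \<delta> / 2 * real N0"
      using \<delta> by (simp add: field_simps)
    then have "real q * B \<le> \<delta> / 2 * real N" if "N \<ge> N0" for N
      using that \<delta> mult_left_mono[of "real N0" "real N" "\<delta> / 2"] by linarith
    then have ev': "\<forall>\<^sub>F N in sequentially. real q * B \<le> \<delta> / 2 * real N"
      using eventually_at_top_linorder by blast
    from ev ev' show ?thesis
      unfolding good_def
    proof eventually_elim
      case (elim N)
      show ?case
      proof
        fix i assume i: "i \<in> I"
        define M where "M = N div q"
        have M: "real M \<le> real N / real q" "real M \<le> real N"
          unfolding M_def by (rule of_nat_div_le_of_nat) simp
        have "\<bar>S i N\<bar> \<le> \<bar>S i (q * M)\<bar> + real (N mod q) * B"
          using S_diff[OF i, of "q * M" "N mod q"] by (simp add: M_def)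
        also have "real (N mod q) * B \<le> real q * B"
          using q B by (intro mult_right_mono) (simp_all add: less_imp_le)
        also have "\<bar>S i (q * M)\<bar> \<le> (\<Sum>j\<in>J i. \<bar>S (\<tau> i j) M\<bar>) + e i M"
          using contraction[OF i, of M] by (simp add: S_def)
        also have "(\<Sum>j\<in>J i. \<bar>S (\<tau> i j) M\<bar>) \<le> (\<Sum>j\<in>J i. u * real M)"
          using elim(1) \<tau>[OF i] by (intro sum_mono) (auto simp: M_def)
        also have "\<dots> = real (card (J i)) * (u * real M)" by simp
        also have "\<dots> \<le> (real q - 1) * (u * real M)"
          using card[OF i] u(2) by (intro mult_right_mono) auto
        also have "\<dots> \<le> (real q - 1) * (u * (real N / real q))"
          using q u(2) M by (intro mult_left_mono) auto
        also have "e i M \<le> \<delta> / 2 * real M"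
          using elim(1) i by (auto simp: M_def)
        also have "\<dots> \<le> \<delta> / 2 * real N" using M \<delta> by simp
        finally show "\<bar>S i N\<bar> \<le> (r * u + \<delta>) * real N"
          using elim(2) by (simp add: r_def algebra_simps)
      qed
    qed
  qed
  define A where "A = {u. 0 \<le> u \<and> good u}"
  define u0 where "u0 = Inf A"
  have A: "A \<noteq> {}" "bdd_below A" "B \<in> A"
    using good_B B by (auto simp: A_def bdd_below_def)
  have "u0 \<ge> 0" unfolding u0_def using A(1) by (intro cInf_greatest) (auto simp: A_def)
  have "u0 \<le> 0"
  proof (rule ccontr)
    assume "\<not> u0 \<le> 0"
    \<comment> \<open>A quarter of the gap \<open>u0 - r * u0\<close>: then
      \<open>r * (u0 + \<eta>) + \<eta>\<close> is at most \<open>r * u0 + 2 * \<eta>\<close>, still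
      below \<open>u0\<close>.\<close>
    define \<eta> where "\<eta> = (1 - r) * u0 / 4"
    have \<eta>: "\<eta> > 0" using r \<open>\<not> u0 \<le> 0\<close> by (simp add: \<eta>_def)
    obtain u where u: "u \<in> A" "u < u0 + \<eta>"
      using cInf_lessD[OF A(1), of "u0 + \<eta>"] \<eta> by (auto simp: u0_def)
    have "r * u + \<eta> \<in> A"
      using u(1) step[of u \<eta>] \<eta> r by (auto simp: A_def)
    then have "u0 \<le> r * u + \<eta>"
      unfolding u0_def by (intro cInf_lower A)
    also have "r * u \<le> r * (u0 + \<eta>)" using u r by (intro mult_left_mono) auto
    finally have "u0 \<le> r * u0 + r * \<eta> + \<eta>" by (simp add: algebra_simps)
    moreover have "r * \<eta> \<le> \<eta>" using r \<eta> by (simp add: mult_left_le_one_le)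
    ultimately have "u0 \<le> r * u0 + 2 * \<eta>" by linarith
    moreover have "2 * \<eta> = (1 - r) * u0 / 2" by (simp add: \<eta>_def)
    moreover have "u0 - r * u0 = (1 - r) * u0" by (simp add: algebra_simps)
    ultimately have "(1 - r) * u0 \<le> (1 - r) * u0 / 2" by linarith
    moreover have "(1 - r) * u0 > 0" using r \<open>\<not> u0 \<le> 0\<close> by simp
    ultimately show False by linarith
  qed
  show ?thesis
    unfolding mean_zero_def
  proof (rule tendstoI)
    fix \<epsilon> :: real assume "\<epsilon> > 0"
    then obtain u where u: "u \<in> A" "u < \<epsilon>"
      using cInf_lessD[OF A(1), of \<epsilon>] \<open>u0 \<le> 0\<close> by (auto simp: u0_def)
    then have "\<forall>\<^sub>F N in sequentially. \<forall>i\<in>I. \<bar>S i N\<bar> \<le> u * real N"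
      by (simp add: A_def good_def)
    then show "\<forall>\<^sub>F N in sequentially. dist ((\<Sum>n<N. f i n) / real N) 0 < \<epsilon>"
      using eventually_gt_at_top[of 0]
    proof eventually_elim
      case (elim N)
      then have "\<bar>S i N\<bar> / real N \<le> u" using \<open>i \<in> I\<close> by (simp add: field_simps)
      then show ?case using u by (simp add: S_def)
    qed
  qed
qed

text \<open>The contraction principle with no remaining sums: \<open>J\<close> is empty and the
  whole sum counts as error. Only the block sums of \<open>f\<close> and \<open>g\<close> must
  agree, which allows the sections to be centred differently from \<open>f\<close>.\<close>

lemma mean_zero_sections:
  assumes q: "q > 0" and bound: "\<And>n. \<bar>f n\<bar> \<le> B"
    and g: "\<And>m. m < q \<Longrightarrow> mean_zero (g m)"
    and sum: "\<And>n. (\<Sum>m<q. f (q * n + m)) = (\<Sum>m<q. g m n)"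
  shows "mean_zero f"
proof (rule mean_zero_contraction[where I = "{()}" and f = "\<lambda>_. f" and J = "\<lambda>_. {}" and q = q
    and e = "\<lambda>_ N. \<bar>\<Sum>n<q * N. f n\<bar>"])
  have "(\<Sum>n<q * N. f n) = (\<Sum>m<q. \<Sum>n<N. g m n)" for N
    unfolding sum_lessThan_mult by (subst (1 2) sum.swap) (simp add: sum)
  then have "(\<lambda>N. \<bar>\<Sum>n<q * N. f n\<bar> / real N) = (\<lambda>N. \<bar>\<Sum>m<q. (\<Sum>n<N. g m n) / real N\<bar>)"
    by (simp add: sum_divide_distrib[symmetric])
  moreover have "(\<lambda>N. \<Sum>m<q. (\<Sum>n<N. g m n) / real N) \<longlonglongrightarrow> (\<Sum>m<q. 0)"
    using g by (intro tendsto_sum) (simp add: mean_zero_def)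
  ultimately show "(\<lambda>N. \<bar>\<Sum>n<q * N. f n\<bar> / real N) \<longlonglongrightarrow> 0"
    by (simp add: tendsto_rabs_zero_iff)
qed (use q bound in auto)

lemma has_asymptotic_density_sections:
  assumes q: "q > 0"
    and S: "\<And>m. m < q \<Longrightarrow> has_asymptotic_density {n. q * n + m \<in> S} (d m)"
  shows "has_asymptotic_density S ((\<Sum>m<q. d m) / real q)"
  unfolding has_asymptotic_density_iff_mean_zero
proof (rule mean_zero_sections[OF q, where B = "1 + \<bar>(\<Sum>m<q. d m) / real q\<bar>"
    and g = "\<lambda>m n. of_bool (n \<in> {n. q * n + m \<in> S}) - d m"])
  show "mean_zero (\<lambda>n. of_bool (n \<in> {n. q * n + m \<in> S}) - d m)" if "m < q" for m
    using S[OF that] by (simp add: has_asymptotic_density_iff_mean_zero)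
  show "\<bar>of_bool (n \<in> S) - (\<Sum>m<q. d m) / real q\<bar> \<le> 1 + \<bar>(\<Sum>m<q. d m) / real q\<bar>" for n
    unfolding of_bool_def by (cases "n \<in> S"; simp only: if_True if_False; linarith)
qed (use q in \<open>simp add: sum_subtractf\<close>)

text \<open>The last digit exchanges \<open>S\<close> and \<open>S'\<close>, and \<open>d\<close>,
  \<open>d'\<close> solve the linear system this forces on the densities. With these centres the
  constants cancel, leaving one recursive section out of \<open>q > 1\<close>. Existence of the
  densities is thus proved along the way.\<close>

lemma has_asymptotic_density_mutual_sections:
  assumes q: "q > 1"
    and S: "\<And>m. m < q - 1 \<Longrightarrow> has_asymptotic_density {n. q * n + m \<in> S} (x m)"
    and S': "\<And>m. m < q - 1 \<Longrightarrow> has_asymptotic_density {n. q * n + m \<in> S'} (y m)"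
    and last: "\<And>n. q * n + (q - 1) \<in> S \<longleftrightarrow> n \<in> S'" "\<And>n. q * n + (q - 1) \<in> S' \<longleftrightarrow> n \<in> S"
    and d: "(\<Sum>m<q - 1. x m) + d' = real q * d" "(\<Sum>m<q - 1. y m) + d = real q * d'"
  shows "has_asymptotic_density S d"
proof -
  define A where "A = (\<lambda>i. if i then S else S')"
  define D where "D = (\<lambda>i. if i then d else d')"
  define z where "z = (\<lambda>i. if i then x else y)"
  define f where "f = (\<lambda>i n. of_bool (n \<in> A i) - D i :: real)"
  define g where "g = (\<lambda>i m n. of_bool (q * n + m \<in> A i) - z i m :: real)"
  have g: "mean_zero (g i m)" if "m < q - 1" for i m
    using S[OF that] S'[OF that]
    by (auto simp: g_def A_def z_def has_asymptotic_density_iff_mean_zero)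
  have D: "(\<Sum>m<q - 1. z i m) + D (\<not> i) = real q * D i" for i
    using d by (simp add: z_def D_def)
  have sum: "(\<Sum>n<q * N. f i n) = (\<Sum>n<N. f (\<not> i) n) + (\<Sum>m<q - 1. \<Sum>n<N. g i m n)" for i N
  proof -
    have "(\<Sum>m<q. f i (q * n + m)) = f (\<not> i) n + (\<Sum>m<q - 1. g i m n)" for n
    proof -
      have "(\<Sum>m<q. f i (q * n + m)) =
          (\<Sum>m<q. of_bool (q * n + m \<in> A i)) - real q * D i"
        by (simp add: f_def sum_subtractf)
      also have "(\<Sum>m<q. of_bool (q * n + m \<in> A i) :: real) =
          (\<Sum>m<q - 1. of_bool (q * n + m \<in> A i)) + of_bool (n \<in> A (\<not> i))"
        using q last by (cases q) (simp_all add: A_def)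
      finally show ?thesis
        using D[of i] by (simp add: f_def g_def sum_subtractf)
    qed
    then show ?thesis
      unfolding sum_lessThan_mult by (subst (1 2) sum.swap) (simp add: sum.distrib)
  qed
  have "mean_zero (f True)"
  proof (rule mean_zero_contraction[where I = UNIV and f = f and J = "\<lambda>_. {()}"
        and \<tau> = "\<lambda>i _. \<not> i" and q = q and B = "1 + \<bar>d\<bar> + \<bar>d'\<bar>"
        and e = "\<lambda>i N. \<bar>\<Sum>m<q - 1. \<Sum>n<N. g i m n\<bar>"])
    show "\<bar>f i n\<bar> \<le> 1 + \<bar>d\<bar> + \<bar>d'\<bar>" for i n
      by (auto simp: f_def D_def)
    show "\<bar>\<Sum>n<q * N. f i n\<bar> \<le>
        (\<Sum>j\<in>{()}. \<bar>\<Sum>n<N. f (\<not> i) n\<bar>) + \<bar>\<Sum>m<q - 1. \<Sum>n<N. g i m n\<bar>" for i N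
      unfolding sum by simp
    show "(\<lambda>N. \<bar>\<Sum>m<q - 1. \<Sum>n<N. g i m n\<bar> / real N) \<longlonglongrightarrow> 0" for i
    proof -
      have "(\<lambda>N. \<Sum>m<q - 1. (\<Sum>n<N. g i m n) / real N) \<longlonglongrightarrow> (\<Sum>m<q - 1. 0)"
        using g by (intro tendsto_sum) (simp add: mean_zero_def)
      then have "(\<lambda>N. \<bar>\<Sum>m<q - 1. (\<Sum>n<N. g i m n) / real N\<bar>) \<longlonglongrightarrow> 0"
        by (simp add: tendsto_rabs_zero_iff)
      then show ?thesis
        by (simp add: sum_divide_distrib[symmetric])
    qed
  qed (use q in auto)
  then show ?thesis
    by (simp add: f_def A_def D_def has_asymptotic_density_iff_mean_zero)
qed

section \<open>Elementary rules for densities\<close>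

lemma has_asymptotic_density_empty: "has_asymptotic_density {} 0"
  by (simp add: has_asymptotic_density_iff_mean_zero mean_zero_def)

lemma has_asymptotic_density_UNIV: "has_asymptotic_density UNIV 1"
  by (simp add: has_asymptotic_density_iff_mean_zero mean_zero_def)

lemma has_asymptotic_density_compl:
  assumes "has_asymptotic_density S d"
  shows "has_asymptotic_density (- S) (1 - d)"
proof -
  have "(\<lambda>N. - ((\<Sum>n<N. of_bool (n \<in> S) - d) / real N)) \<longlonglongrightarrow> - 0"
    using assms unfolding has_asymptotic_density_iff_mean_zero mean_zero_def by (rule tendsto_minus)
  also have "(\<lambda>N. - ((\<Sum>n<N. of_bool (n \<in> S) - d) / real N)) =
      (\<lambda>N. (\<Sum>n<N. of_bool (n \<in> - S) - (1 - d)) / real N)"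
    unfolding minus_divide_left sum_negf[symmetric]
    by (intro ext arg_cong2[where f = "(/)"] sum.cong refl) auto
  finally show ?thesis
    by (simp add: has_asymptotic_density_iff_mean_zero mean_zero_def)
qed

lemma has_asymptotic_density_0_subset_Un:
  assumes "has_asymptotic_density S 0" "has_asymptotic_density T 0" "U \<subseteq> S \<union> T"
  shows "has_asymptotic_density U 0"
  unfolding has_asymptotic_density_def
proof (rule tendsto_sandwich[where f = "\<lambda>_. 0"])
  show "(\<lambda>N. real (card (S \<inter> {n. n < N})) / real N + real (card (T \<inter> {n. n < N})) / real N)
      \<longlonglongrightarrow> 0"
    using tendsto_add[OF assms(1,2)[unfolded has_asymptotic_density_def]] by simp
  have "card (U \<inter> {n. n < N}) \<le> card (S \<inter> {n. n < N}) + card (T \<inter> {n. n < N})" for N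
  proof -
    have "card (U \<inter> {n. n < N}) \<le> card (S \<inter> {n. n < N} \<union> T \<inter> {n. n < N})"
      using assms(3) by (intro card_mono) auto
    also have "\<dots> \<le> card (S \<inter> {n. n < N}) + card (T \<inter> {n. n < N})"
      by (rule card_Un_le)
    finally show ?thesis .
  qed
  then show "\<forall>\<^sub>F N in sequentially. real (card (U \<inter> {n. n < N})) / real N \<le>
      real (card (S \<inter> {n. n < N})) / real N + real (card (T \<inter> {n. n < N})) / real N"
    unfolding add_divide_distrib[symmetric] of_nat_add[symmetric]
    by (intro always_eventually allI divide_right_mono) (simp_all only: of_nat_le_iff of_nat_0_le_iff)
qed simp_all

section \<open>Sequences satisfying a Lucas congruence\<close>

lemma cong_mult_inverse_iff:
  fixes x y z w m :: int
  assumes "[z * w = 1] (mod m)"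
  shows "[x * z = y] (mod m) \<longleftrightarrow> [x = y * w] (mod m)"
proof
  assume "[x * z = y] (mod m)"
  then have "[x * z * w = y * w] (mod m)" by (rule cong_mult) simp
  moreover have "[x * (z * w) = x * 1] (mod m)" using assms by (intro cong_mult cong_refl)
  ultimately show "[x = y * w] (mod m)"
    by (metis cong_sym cong_trans mult.assoc mult.right_neutral)
next
  assume "[x = y * w] (mod m)"
  then have "[x * z = y * w * z] (mod m)" by (rule cong_mult) simp
  moreover have "[y * (z * w) = y * 1] (mod m)" using assms by (intro cong_mult cong_refl)
  ultimately show "[x * z = y] (mod m)"
    by (metis cong_trans mult.assoc mult.commute mult.right_neutral)
qed

lemma fermat_int:
  assumes "prime p" "\<not> int p dvd x"
  shows "[x ^ (p - 1) = 1] (mod int p)"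
proof -
  have "int (nat (x mod int p)) = x mod int p"
    using assms by (simp add: prime_gt_0_nat)
  moreover have "\<not> p dvd nat (x mod int p)"
    using assms calculation by (metis dvd_mod_iff int_dvd_int_iff dvd_refl)
  ultimately have "[(x mod int p) ^ (p - 1) = 1] (mod int p)"
    using fermat_theorem[OF assms(1), of "nat (x mod int p)"]
    by (metis cong_int_iff of_nat_1 of_nat_power)
  then show ?thesis
    by (simp add: cong_def power_mod)
qed

lemma fermat_inverse:
  assumes "prime p" "\<not> int p dvd x"
  shows "[x * x ^ (p - 2) = 1] (mod int p)"
proof -
  have "x * x ^ (p - 2) = x ^ (p - 1)"
    using prime_ge_2_nat[OF assms(1)]
    by (metis Suc_1 Suc_diff_Suc Suc_le_lessD power_Suc)
  then show ?thesis using fermat_int[OF assms] by simp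
qed

locale lucas_sequence =
  fixes p :: nat and t :: "nat \<Rightarrow> int"
  assumes prime: "prime p"
    and t_0: "t 0 = 1"
    and lucas: "m < p \<Longrightarrow> [t (p * n + m) = t n * t m] (mod int p)"
begin

lemma p_ge_2: "p \<ge> 2"
  using prime by (rule prime_ge_2_nat)

lemma not_dvd_prod: "\<not> int p dvd x \<Longrightarrow> \<not> int p dvd y \<Longrightarrow> \<not> int p dvd x * y"
  using prime by (simp add: prime_dvd_mult_iff)

lemma not_dvd_power: "\<not> int p dvd x \<Longrightarrow> \<not> int p dvd x ^ j"
  using prime prime_dvd_power[of "int p" x j] by auto

lemma lucas_digit:
  assumes "m < p"
  shows "int p dvd t (p * n + m) \<longleftrightarrow> int p dvd t n \<or> int p dvd t m"
  using cong_dvd_iff[OF lucas[OF assms, of n]] prime by (simp add: prime_dvd_mult_iff)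

text \<open>The indicator of nonzero values is multiplicative in the digits, and the vanishing digit
  deletes one of the \<open>p\<close> sections.\<close>

lemma density_nonzero:
  assumes "m < p" "int p dvd t m"
  shows "has_asymptotic_density {n. \<not> int p dvd t n} 0"
proof -
  define f :: "nat \<Rightarrow> real" where "f = (\<lambda>n. of_bool (\<not> int p dvd t n))"
  define J where "J = {m. m < p \<and> \<not> int p dvd t m}"
  have J: "J \<subset> {..<p}" "finite J" using assms by (auto simp: J_def)
  then have "card J < card {..<p}" by (intro psubset_card_mono) auto
  then have card: "card J < p" by simp
  have "mean_zero f"
  proof (rule mean_zero_contraction[where I = "{()}" and f = "\<lambda>_. f" and J = "\<lambda>_. J" and q = p
      and e = "\<lambda>_ _. 0" and B = 1])
    fix N
    have "(\<Sum>n<p * N. f n) = (\<Sum>m<p. \<Sum>n<N. f n * f m)"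
      unfolding sum_lessThan_mult by (intro sum.cong refl) (auto simp: f_def lucas_digit)
    also have "\<dots> = (\<Sum>n<N. f n) * (\<Sum>m<p. f m)"
      by (subst sum.swap) (simp add: sum_product)
    also have "(\<Sum>m<p. f m) = real (card J)"
      by (simp add: f_def of_bool_def sum.If_cases J_def lessThan_def Int_def)
    finally show "\<bar>\<Sum>n<p * N. f n\<bar> \<le> (\<Sum>j\<in>J. \<bar>\<Sum>n<N. f n\<bar>) + 0"
      by (simp add: abs_mult)
  qed (use card in \<open>auto simp: f_def\<close>)
  then show ?thesis
    by (simp add: has_asymptotic_density_iff_mean_zero f_def)
qed

text \<open>Splitting off the lowest digit in base \<open>p\<close> shows that the Lucas property
  persists in base \<open>p ^ j\<close>.\<close>

lemma lucas_power:
  "m < p ^ j \<Longrightarrow> [t (p ^ j * n + m) = t n * t m] (mod int p)"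
proof (induction j arbitrary: m)
  case 0
  then show ?case by (simp add: t_0)
next
  case (Suc j)
  define r where "r = m mod p"
  define m' where "m' = m div p"
  have m: "m = p * m' + r" and r: "r < p"
    using p_ge_2 by (auto simp: m'_def r_def)
  have m': "m' < p ^ j"
    using Suc.prems by (simp add: m'_def less_mult_imp_div_less mult.commute)
  have "p ^ Suc j * n + m = p * (p ^ j * n + m') + r"
    by (simp add: m algebra_simps)
  then have "[t (p ^ Suc j * n + m) = t (p ^ j * n + m') * t r] (mod int p)"
    using lucas[OF r] by simp
  also have "[t (p ^ j * n + m') * t r = t n * t m' * t r] (mod int p)"
    by (intro cong_mult cong_refl Suc.IH m')
  also have "[t n * t m' * t r = t n * t m] (mod int p)"
    unfolding mult.assoc m using lucas[OF r, of m'] by (intro cong_mult cong_refl) (rule cong_sym)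
  finally show ?case .
qed

end

section \<open>Equidistribution for Lucas sequences without zeros modulo \<open>p\<close>\<close>

locale nonvanishing_lucas_sequence = lucas_sequence +
  assumes digits: "m < p \<Longrightarrow> \<not> int p dvd t m"
begin

lemma nonvanishing: "\<not> int p dvd t n"
proof (induction n rule: less_induct)
  case (less n)
  show ?case
  proof (cases "n < p")
    case False
    then have "\<not> int p dvd t (n div p)"
      using p_ge_2 by (intro less) (simp add: div_less_dividend)
    then show ?thesis
      using lucas_digit[of "n mod p" "n div p"] digits[of "n mod p"] p_ge_2 by simp
  qed (rule digits)
qed

definition value_set :: "int set" where
  "value_set = (\<lambda>n. t n mod int p) ` UNIV"

lemma value_set_subset: "value_set \<subseteq> {1..int p - 1}"
proof
  fix x assume "x \<in> value_set"
  then obtain n where n: "x = t n mod int p" by (auto simp: value_set_def)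
  have "x \<noteq> 0" using nonvanishing[of n] n by (simp add: dvd_eq_mod_eq_0)
  moreover have "0 \<le> x" "x < int p" using n p_ge_2 by simp_all
  ultimately show "x \<in> {1..int p - 1}" by simp
qed

lemma value_set_mult:
  assumes "x \<in> value_set" "y \<in> value_set"
  shows "x * y mod int p \<in> value_set"
proof -
  obtain n m where nm: "x = t n mod int p" "y = t m mod int p"
    using assms by (auto simp: value_set_def)
  \<comment> \<open>Any power of \<open>p\<close> above \<open>m\<close> would do: the digits of
    \<open>m\<close> are appended to those of \<open>n\<close>.\<close>
  have "m < p ^ m" using p_ge_2 by (simp add: power_gt_expt)
  then have "t (p ^ m * n + m) mod int p = x * y mod int p"
    using lucas_power[of m m n] by (simp add: nm cong_def mod_mult_eq)
  then show ?thesis by (metis value_set_def rangeI)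
qed

lemma value_set_power: "x \<in> value_set \<Longrightarrow> x ^ j mod int p \<in> value_set"
proof (induction j)
  case 0
  have "t 0 mod int p = 1" using p_ge_2 by (simp add: t_0)
  then show ?case using p_ge_2 by (metis value_set_def rangeI power_0 t_0)
next
  case (Suc j)
  then have "x * (x ^ j mod int p) mod int p \<in> value_set"
    by (intro value_set_mult)
  then show ?case by (simp add: mod_mult_right_eq)
qed

text \<open>The values are closed under products, hence under powers, and the inverse of
  \<open>h\<close> is the power \<open>h ^ (p - 2)\<close>. So they contain the generated
  group.\<close>

lemma value_set_generated:
  assumes "generate (units_of (residue_ring (int p))) ((\<lambda>n. t n mod int p) ` {n. n \<le> p - 1})
      = carrier (units_of (residue_ring (int p)))"
  shows "value_set = {1..int p - 1}"
proof -
  interpret residues_prime p "residue_ring (int p)"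
    by unfold_locales (rule prime)
  let ?U = "units_of (residue_ring (int p))"
  have "x \<in> value_set" if "x \<in> generate ?U ((\<lambda>n. t n mod int p) ` {n. n \<le> p - 1})" for x
    using that
  proof (induction x rule: generate.induct)
    case one
    have "1 = t 0 mod int p" using p_ge_2 by (simp add: t_0)
    then show ?case by (simp add: units_of_one res_one_eq value_set_def)
  next
    case (incl h)
    then show ?case by (auto simp: value_set_def)
  next
    case (inv h)
    then have h: "h \<in> value_set" by (auto simp: value_set_def)
    define y where "y = h ^ (p - 2) mod int p"
    have y: "y \<in> value_set" unfolding y_def by (rule value_set_power) (rule h)
    have units: "h \<in> carrier ?U" "y \<in> carrier ?U"
      using h y value_set_subset by (auto simp: units_of_carrier res_prime_units_eq)
    have "\<not> int p dvd h"
      using h nonvanishing by (auto simp: value_set_def dvd_mod_iff)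
    then have "y * h mod int p = 1 mod int p"
      using fermat_inverse[OF prime, of h]
      unfolding y_def cong_def mod_mult_left_eq mult.commute[of "h ^ (p - 2)"] by blast
    then have "y \<otimes>\<^bsub>?U\<^esub> h = \<one>\<^bsub>?U\<^esub>"
      using p_ge_2 by (simp add: units_of_mult units_of_one res_mult_eq res_one_eq)
    then have "inv\<^bsub>?U\<^esub> h = y"
      using units by (intro group.inv_equality units_group)
    then show ?case using y by simp
  next
    case (eng h1 h2)
    then show ?case by (simp add: units_of_mult res_mult_eq value_set_mult)
  qed
  with assms have "{1..int p - 1} \<subseteq> value_set"
    by (auto simp: units_of_carrier res_prime_units_eq)
  with value_set_subset show ?thesis by blast
qed

text \<open>By \<open>lucas_power\<close> we may pass to a base \<open>q = p ^ J\<close> in which the digits already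
  take every nonzero residue. One representative digit per residue then contributes a total of
  zero, which leaves fewer than \<open>q\<close> sections.\<close>

lemma density_value:
  assumes onto: "value_set = {1..int p - 1}" and k: "\<not> int p dvd k"
  shows "has_asymptotic_density {n. [t n = k] (mod int p)} (1 / (real p - 1))"
proof -
  define G where "G = {1..int p - 1}"
  have card_G: "real (card G) = real p - 1" using p_ge_2 by (simp add: G_def of_nat_diff)
  have G_iff: "x mod int p \<in> G \<longleftrightarrow> \<not> int p dvd x" for x
  proof -
    have "0 \<le> x mod int p" "x mod int p < int p" using p_ge_2 by simp_all
    then show ?thesis by (simp only: G_def dvd_eq_mod_eq_0 atLeastAtMost_iff) linarith
  qed
  have G_mod: "x mod int p = x" if "x \<in> G" for x
    using that by (simp add: G_def)
  obtain rep where rep: "t (rep x) mod int p = x" if "x \<in> G" for x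
  proof -
    have "\<exists>n. t n mod int p = x" if "x \<in> G" for x
    proof -
      have "x \<in> value_set" using that onto by (simp add: G_def)
      then show ?thesis by (auto simp: value_set_def)
    qed
    then show thesis by (metis that)
  qed
  \<comment> \<open>Since \<open>p ^ J > J\<close>, every representative index is a digit in base
    \<open>q\<close>.\<close>
  define J where "J = Max (rep ` G)"
  define q where "q = p ^ J"
  have rep_less: "rep x < q" if "x \<in> G" for x
  proof -
    have "rep x \<le> J" unfolding J_def using that by (intro Max_ge) (auto simp: G_def)
    also have "J < q" using p_ge_2 by (simp add: q_def power_gt_expt)
    finally show ?thesis .
  qed
  have inj: "inj_on rep G" using rep by (metis inj_onI)
  define f :: "int \<Rightarrow> nat \<Rightarrow> real"
    where "f = (\<lambda>k n. of_bool ([t n = k] (mod int p)) - 1 / (real p - 1))"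
  \<comment> \<open>Appending the digit \<open>m\<close> multiplies by \<open>t m\<close>, so the
    section asks for the value \<open>k / t m\<close>.\<close>
  define \<tau> where "\<tau> k m = k * t m ^ (p - 2) mod int p" for k m
  have sections: "f k (q * n + m) = f (\<tau> k m) n" if "m < q" for k n m
  proof -
    have "[t (q * n + m) = k] (mod int p) \<longleftrightarrow> [t n * t m = k] (mod int p)"
      using lucas_power[of m J n] that unfolding q_def by (metis cong_sym cong_trans)
    also have "\<dots> \<longleftrightarrow> [t n = k * t m ^ (p - 2)] (mod int p)"
      by (intro cong_mult_inverse_iff fermat_inverse prime nonvanishing)
    finally show ?thesis by (simp add: f_def \<tau>_def cong_def)
  qed
  \<comment> \<open>As \<open>x\<close> runs through \<open>G\<close>, the product
    \<open>x * t n\<close> equals \<open>k\<close> exactly once; the \<open>p - 1\<close> centring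
    terms subtract this 1 again.\<close>
  have rep_sum: "(\<Sum>m\<in>rep ` G. f k (q * n + m)) = 0" if "k \<in> G" for k n
  proof -
    define c where "c = k * t n ^ (p - 2) mod int p"
    have c: "c \<in> G"
      unfolding c_def G_iff using G_iff[of k] that
      by (intro not_dvd_prod not_dvd_power nonvanishing) (simp add: G_mod)
    have "[t (q * n + rep x) = k] (mod int p) \<longleftrightarrow> x = c" if "x \<in> G" for x
    proof -
      have "[t (q * n + rep x) = x * t n] (mod int p)"
        using lucas_power[of "rep x" J n] rep_less[OF that] rep[OF that]
        by (metis cong_def mod_mult_right_eq mult.commute q_def)
      then have "[t (q * n + rep x) = k] (mod int p) \<longleftrightarrow> [x * t n = k] (mod int p)"
        by (metis cong_sym cong_trans)
      also have "\<dots> \<longleftrightarrow> [x = k * t n ^ (p - 2)] (mod int p)"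
        by (intro cong_mult_inverse_iff fermat_inverse prime nonvanishing)
      finally show ?thesis using G_mod[OF that] by (simp add: c_def cong_def)
    qed
    then have "(\<Sum>m\<in>rep ` G. f k (q * n + m)) = (\<Sum>x\<in>G. of_bool (x = c) - 1 / (real p - 1))"
      unfolding sum.reindex[OF inj] by (intro sum.cong refl) (simp add: f_def)
    also have "\<dots> = (\<Sum>x\<in>G. of_bool (x = c)) - 1"
      using card_G p_ge_2 by (simp add: sum_subtractf)
    also have "(\<Sum>x\<in>G. of_bool (x = c) :: real) = 1"
      using c by (simp add: of_bool_def G_def)
    finally show ?thesis by simp
  qed
  have "mean_zero (f (k mod int p))"
  proof (rule mean_zero_contraction[where I = G and f = f and J = "\<lambda>_. {..<q} - rep ` G" and q = q
      and \<tau> = \<tau> and e = "\<lambda>_ _. 0" and B = "1 + \<bar>1 / (real p - 1)\<bar>"])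
    show "finite G" by (simp add: G_def)
    show "\<bar>f k n\<bar> \<le> 1 + \<bar>1 / (real p - 1)\<bar>" for k n
      unfolding f_def of_bool_def
      by (cases "[t n = k] (mod int p)"; simp only: if_True if_False; linarith)
    have "1 \<in> G" using p_ge_2 by (simp add: G_def)
    then have "rep 1 \<in> {..<q}" "rep 1 \<in> rep ` G" using rep_less by auto
    then have "{..<q} - rep ` G \<subset> {..<q}" by blast
    then have "card ({..<q} - rep ` G) < card {..<q}" by (intro psubset_card_mono) auto
    then show "card ({..<q} - rep ` G) < q" by simp
    show "\<tau> k m \<in> G" if "k \<in> G" for k m
      unfolding \<tau>_def G_iff using G_iff[of k] that
      by (intro not_dvd_prod not_dvd_power nonvanishing) (simp add: G_mod)
    show "k mod int p \<in> G" using k by (simp add: G_iff)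
    fix k N assume "k \<in> G"
    have "(\<Sum>n<q * N. f k n) = (\<Sum>m<q. \<Sum>n<N. f k (q * n + m))"
      by (rule sum_lessThan_mult)
    also have "\<dots> = (\<Sum>m\<in>{..<q} - rep ` G. \<Sum>n<N. f k (q * n + m))
        + (\<Sum>m\<in>rep ` G. \<Sum>n<N. f k (q * n + m))"
      using rep_less by (intro sum.subset_diff) auto
    also have "(\<Sum>m\<in>rep ` G. \<Sum>n<N. f k (q * n + m)) = 0"
      by (subst sum.swap) (simp add: rep_sum[OF \<open>k \<in> G\<close>])
    also have "(\<Sum>m\<in>{..<q} - rep ` G. \<Sum>n<N. f k (q * n + m)) =
        (\<Sum>m\<in>{..<q} - rep ` G. \<Sum>n<N. f (\<tau> k m) n)"
      by (intro sum.cong refl) (simp add: sections)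
    finally show "\<bar>\<Sum>n<q * N. f k n\<bar> \<le> (\<Sum>m\<in>{..<q} - rep ` G. \<bar>\<Sum>n<N. f (\<tau> k m) n\<bar>) + 0"
      by simp
  qed auto
  then show ?thesis
    by (simp add: has_asymptotic_density_iff_mean_zero f_def cong_def)
qed

text \<open>The density of the value \<open>k\<close> in a sequence that is zero modulo \<open>p\<close> with density \<open>d\<close> and
  otherwise equidistributed.\<close>

definition equi_density :: "int \<Rightarrow> real \<Rightarrow> real" where
  "equi_density k d = (if int p dvd k then d else (1 - d) / (real p - 1))"

lemma sum_equi_density:
  "(\<Sum>m\<in>A. equi_density k (d m)) =
     (if int p dvd k then (\<Sum>m\<in>A. d m) else (real (card A) - (\<Sum>m\<in>A. d m)) / (real p - 1))"
  by (simp add: equi_density_def sum_subtractf flip: sum_divide_distrib)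

text \<open>For \<open>s\<close> divisible by \<open>p\<close> the sequence is zero modulo
  \<open>p\<close>; otherwise it has no zeros and a nonzero value \<open>k\<close> is taken where
  \<open>t n\<close> equals \<open>k / s\<close>. The disjunction \<open>k\<close> lets zero and
  nonzero values share one statement.\<close>

lemma density_multiple:
  assumes k: "int p dvd k \<or> value_set = {1..int p - 1}"
  shows "has_asymptotic_density {n. [t n * s = k] (mod int p)} (equi_density k (of_bool (int p dvd s)))"
proof (cases "int p dvd s")
  case True
  then have "[t n * s = k] (mod int p) \<longleftrightarrow> int p dvd k" for n
    by (metis cong_dvd_iff cong_sym cong_0_iff cong_trans dvd_mult)
  with True show ?thesis
    by (cases "int p dvd k")
      (simp_all add: equi_density_def has_asymptotic_density_empty has_asymptotic_density_UNIV)
next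
  case False
  show ?thesis
  proof (cases "int p dvd k")
    case True
    then have "\<not> [t n * s = k] (mod int p)" for n
      using cong_dvd_iff[of "t n * s" k "int p"] not_dvd_prod[OF nonvanishing False] by blast
    with True False show ?thesis
      by (simp add: equi_density_def has_asymptotic_density_empty)
  next
    case k': False
    have "\<not> int p dvd k * s ^ (p - 2)"
      using k' False by (intro not_dvd_prod not_dvd_power)
    moreover have "[t n * s = k] (mod int p) \<longleftrightarrow> [t n = k * s ^ (p - 2)] (mod int p)" for n
      by (intro cong_mult_inverse_iff fermat_inverse prime False)
    ultimately show ?thesis
      using density_value[of "k * s ^ (p - 2)"] k k' False by (simp add: equi_density_def)
  qed
qed

text \<open>A digit below \<open>p - 1\<close> gives a multiple of \<open>t n\<close>. The digit
  \<open>p - 1\<close> replaces \<open>\<alpha>\<close> by \<open>\<alpha> * t (p - 1)\<close>, and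
  doing so twice restores \<open>\<alpha>\<close>. Counting zero digits yields
  \<open>card A + d' = p * d\<close> and \<open>card B + d = p * d'\<close>, whose solution is the
  stated density.\<close>

lemma density_consecutive:
  fixes \<alpha> \<beta> :: int
  assumes k: "int p dvd k \<or> value_set = {1..int p - 1}"
    and t_last: "[t (p - 1) * t (p - 1) = 1] (mod int p)"
  defines "A \<equiv> {m. m < p - 1 \<and> int p dvd \<alpha> * t m + \<beta> * t (m + 1)}"
    and "B \<equiv> {m. m < p - 1 \<and> int p dvd \<alpha> * t (p - 1) * t m + \<beta> * t (m + 1)}"
  shows "has_asymptotic_density {n. [\<alpha> * t n + \<beta> * t (n + 1) = k] (mod int p)}
    (equi_density k ((real p * real (card A) + real (card B)) / ((real p - 1) * (real p + 1))))"
proof -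
  define v where "v \<gamma> n = \<gamma> * t n + \<beta> * t (n + 1)" for \<gamma> n
  have first: "[v \<gamma> (p * n + m) = t n * v \<gamma> m] (mod int p)" if "m < p - 1" for \<gamma> n m
  proof -
    have "[\<gamma> * t (p * n + m) + \<beta> * t (p * n + (m + 1)) =
        \<gamma> * (t n * t m) + \<beta> * (t n * t (m + 1))] (mod int p)"
      using that by (intro cong_add cong_mult cong_refl lucas) auto
    then show ?thesis by (simp add: v_def algebra_simps)
  qed
  have last: "[v \<gamma> (p * n + (p - 1)) = v (\<gamma> * t (p - 1)) n] (mod int p)" for \<gamma> n
  proof -
    \<comment> \<open>The carry: the successor has lowest digit 0, which contributes
      \<open>t 0 = 1\<close>.\<close>
    have "p * n + (p - 1) + 1 = p * (n + 1) + 0" using p_ge_2 by simp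
    then have "[t (p * n + (p - 1) + 1) = t (n + 1) * t 0] (mod int p)"
      using lucas[of 0 "n + 1"] prime_gt_0_nat[OF prime] by metis
    then have "[t (p * n + (p - 1) + 1) = t (n + 1)] (mod int p)"
      by (simp only: t_0 mult_1_right)
    moreover have "[t (p * n + (p - 1)) = t n * t (p - 1)] (mod int p)"
      using p_ge_2 by (intro lucas) simp
    ultimately have "[\<gamma> * t (p * n + (p - 1)) + \<beta> * t (p * n + (p - 1) + 1) =
        \<gamma> * (t n * t (p - 1)) + \<beta> * t (n + 1)] (mod int p)"
      by (intro cong_add cong_mult cong_refl)
    then show ?thesis by (simp add: v_def algebra_simps)
  qed
  have again: "[v (\<alpha> * t (p - 1) * t (p - 1)) n = v \<alpha> n] (mod int p)" for n
  proof -
    have "[\<alpha> * (t (p - 1) * t (p - 1)) * t n + \<beta> * t (n + 1) =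
        \<alpha> * 1 * t n + \<beta> * t (n + 1)] (mod int p)"
      by (intro cong_add cong_mult cong_refl t_last)
    then show ?thesis by (simp add: v_def mult.assoc)
  qed
  have sections: "has_asymptotic_density {n. p * n + m \<in> {n. [v \<gamma> n = k] (mod int p)}}
      (equi_density k (of_bool (int p dvd v \<gamma> m)))" if "m < p - 1" for \<gamma> m
  proof -
    have "[v \<gamma> (p * n + m) = k] (mod int p) \<longleftrightarrow> [t n * v \<gamma> m = k] (mod int p)" for n
      using first[OF that] by (metis cong_sym cong_trans)
    then show ?thesis using density_multiple[OF k] by simp
  qed
  have card: "(\<Sum>m<p - 1. of_bool (int p dvd v \<gamma> m) :: real) =
      real (card {m. m < p - 1 \<and> int p dvd v \<gamma> m})" for \<gamma>
    by (simp add: of_bool_def sum.If_cases lessThan_def Int_def)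
  have AB: "A = {m. m < p - 1 \<and> int p dvd v \<alpha> m}"
    "B = {m. m < p - 1 \<and> int p dvd v (\<alpha> * t (p - 1)) m}"
    by (simp_all add: A_def B_def v_def)
  define d where "d = (real p * real (card A) + real (card B)) / ((real p - 1) * (real p + 1))"
  define d' where "d' = (real p * real (card B) + real (card A)) / ((real p - 1) * (real p + 1))"
  have p1: "real p - 1 > 0" "real p + 1 > 0" using p_ge_2 by simp_all
  have d: "real (card A) + d' = real p * d" "real (card B) + d = real p * d'"
  proof -
    have "real p * real p - 1 > 0" using mult_pos_pos[OF p1] by (simp add: algebra_simps)
    then show "real (card A) + d' = real p * d" "real (card B) + d = real p * d'"
      by (simp_all add: d_def d'_def field_simps)
  qed
  have "has_asymptotic_density {n. [v \<alpha> n = k] (mod int p)} (equi_density k d)"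
  proof (rule has_asymptotic_density_mutual_sections[where q = p
        and S' = "{n. [v (\<alpha> * t (p - 1)) n = k] (mod int p)}"])
    show "p > 1" using p_ge_2 by simp
    show "p * n + (p - 1) \<in> {n. [v \<alpha> n = k] (mod int p)} \<longleftrightarrow>
        n \<in> {n. [v (\<alpha> * t (p - 1)) n = k] (mod int p)}" for n
      using last[of \<alpha> n] unfolding mem_Collect_eq by (metis cong_sym cong_trans)
    show "p * n + (p - 1) \<in> {n. [v (\<alpha> * t (p - 1)) n = k] (mod int p)} \<longleftrightarrow>
        n \<in> {n. [v \<alpha> n = k] (mod int p)}" for n
      using last[of "\<alpha> * t (p - 1)" n] again[of n] unfolding mem_Collect_eq
      by (metis cong_sym cong_trans)
    \<comment> \<open>The equation for zero densities also gives the one for nonzero values, because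
      \<open>equi_density\<close> is affine in the density and there are \<open>p - 1\<close> digits
      besides the last.\<close>
    have combine: "(if int p dvd k then x else (real (card {..<p - 1}) - x) / (real p - 1))
        + equi_density k y = real p * equi_density k z" if "x + y = real p * z" for x y z
    proof -
      have "(real p - 1 - x) / (real p - 1) + (1 - y) / (real p - 1) =
          real p * (1 - z) / (real p - 1)"
        using that by (simp add: algebra_simps flip: add_divide_distrib)
      then show ?thesis
        using that p_ge_2 by (simp add: equi_density_def of_nat_diff)
    qed
    show "(\<Sum>m<p - 1. equi_density k (of_bool (int p dvd v \<alpha> m))) + equi_density k d' =
        real p * equi_density k d"
      unfolding sum_equi_density card AB[symmetric] by (rule combine) (rule d)
    show "(\<Sum>m<p - 1. equi_density k (of_bool (int p dvd v (\<alpha> * t (p - 1)) m))) + equi_density k d =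
        real p * equi_density k d'"
      unfolding sum_equi_density card AB[symmetric] by (rule combine) (rule d)
  qed (erule sections)+
  then show ?thesis by (simp add: v_def d_def)
qed

end

section \<open>Generalized Motzkin numbers modulo a prime\<close>

lemma lucas_sequence_central_trinomial:
  assumes "prime p"
  shows "lucas_sequence p (central_trinomial a b)"
  using assms by unfold_locales (simp_all add: central_trinomial_0 central_trinomial_lucas)

text \<open>Modulo \<open>p\<close> the three-term recurrence can be read backwards from
  \<open>p - 1\<close>: with \<open>q = p - m - 3\<close>, the coefficients \<open>q + 2\<close>,
  \<open>2 * q + 3\<close>, \<open>q + 1\<close> become \<open>- (m + 1)\<close>,
  \<open>- (2 * m + 3)\<close>, \<open>- (m + 2)\<close>. Both sides then satisfy the recurrence of
  \<open>T\<close> in \<open>m\<close>.\<close>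

lemma central_trinomial_reflect:
  fixes a b p m :: nat
  assumes p: "prime p" and "m < p"
  defines "T \<equiv> central_trinomial a b" and "\<Delta> \<equiv> (int b)\<^sup>2 - 4 * (int a)\<^sup>2"
  shows "[\<Delta> ^ m * T (p - 1 - m) = T (p - 1) * T m] (mod int p)"
  using \<open>m < p\<close>
proof (induction m rule: induct_nat_012)
  case 0
  show ?case by (simp add: T_def central_trinomial_0)
next
  case 1
  define q where "q = p - 2"
  with 1 have q: "p = q + 2" by simp
  \<comment> \<open>The recurrence at \<open>q = p - 2\<close>, where the leading coefficient is
    \<open>p\<close> and the others are \<open>- 1\<close> modulo \<open>p\<close>.\<close>
  have "\<Delta> * T q - int b * T (q + 1) =
      int (q + 2) * (\<Delta> * T q - 2 * int b * T (q + 1) + T (q + 2))"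
    using central_trinomial_recurrence[of q a b] by (simp add: T_def \<Delta>_def algebra_simps)
  then have "int p dvd \<Delta> * T q - int b * T (q + 1)"
    unfolding q by simp
  then show ?case
    by (simp add: q T_def central_trinomial_1 cong_iff_dvd_diff mult.commute)
next
  case (ge2 m)
  define q where "q = p - m - 3"
  with ge2.prems have q: "p = m + q + 3" by simp
  let ?t = "T (p - 1)"
  have idx: "p - 1 - m = q + 2" "p - 1 - Suc m = q + 1" "p - 1 - Suc (Suc m) = q"
    using q by simp_all
  have "int (m + 2) * (\<Delta> ^ (m + 2) * T q - ?t * T (m + 2)) =
      \<Delta> ^ (m + 1) * (int (m + 2) * \<Delta> * T q) - ?t * (int (m + 2) * T (m + 2))"
    by (simp add: algebra_simps)
  also have "int (m + 2) * \<Delta> * T q = int p * (\<Delta> * T q + T (q + 2) - 2 * int b * T (q + 1))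
      + int (2 * m + 3) * int b * T (q + 1) - int (m + 1) * T (q + 2)"
    using central_trinomial_recurrence[of q a b] by (simp add: T_def \<Delta>_def q algebra_simps)
  also have "int (m + 2) * T (m + 2) =
      int (2 * m + 3) * int b * T (m + 1) - int (m + 1) * \<Delta> * T m"
    unfolding T_def \<Delta>_def by (rule central_trinomial_recurrence)
  also have "\<Delta> ^ (m + 1) * (int p * (\<Delta> * T q + T (q + 2) - 2 * int b * T (q + 1))
        + int (2 * m + 3) * int b * T (q + 1) - int (m + 1) * T (q + 2))
      - ?t * (int (2 * m + 3) * int b * T (m + 1) - int (m + 1) * \<Delta> * T m) =
      int p * (\<Delta> ^ (m + 1) * (\<Delta> * T q + T (q + 2) - 2 * int b * T (q + 1)))
      + int (2 * m + 3) * int b * (\<Delta> ^ Suc m * T (q + 1) - ?t * T (Suc m))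
      - int (m + 1) * \<Delta> * (\<Delta> ^ m * T (q + 2) - ?t * T m)"
    by (simp add: algebra_simps)
  also have "int p dvd \<dots>"
  proof -
    have "int p dvd \<Delta> ^ m * T (q + 2) - ?t * T m"
      "int p dvd \<Delta> ^ Suc m * T (q + 1) - ?t * T (Suc m)"
      using ge2 unfolding idx cong_iff_dvd_diff by simp_all
    from dvd_mult[OF this(1)] dvd_mult[OF this(2)] show ?thesis
      by (intro dvd_diff dvd_add dvd_triv_left)
  qed
  finally have "int p dvd int (m + 2) * (\<Delta> ^ (m + 2) * T q - ?t * T (m + 2))" .
  \<comment> \<open>As \<open>m + 2 < p\<close>, the leading coefficient of the recurrence can be
    cancelled.\<close>
  moreover have "\<not> int p dvd int (m + 2)"
    using ge2.prems by (auto dest: zdvd_imp_le)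
  ultimately show ?case
    using p unfolding idx by (simp add: prime_dvd_mult_iff cong_iff_dvd_diff)
qed

text \<open>The coefficients of \<open>P ^ (p - 2)\<close> and \<open>P ^ (p - 1)\<close> that overlap the next block produce
  the terms in \<open>T (n + 1)\<close>.\<close>

lemma gen_motzkin_last_digits:
  fixes a b p n :: nat
  assumes p: "prime p" and "p > 2" and a: "\<not> p dvd a"
  defines "T \<equiv> central_trinomial a b" and "\<Delta> \<equiv> (int b)\<^sup>2 - 4 * (int a)\<^sup>2"
  shows "[2 * (int a)\<^sup>2 * gen_motzkin a b (p * n + (p - 2)) =
      int b * T (p - 1) * T n - T (n + 1)] (mod int p)" (is ?first)
    and "[2 * (int a)\<^sup>2 * gen_motzkin a b (p * n + (p - 1)) =
      int b * T (n + 1) - \<Delta> * T (p - 1) * T n] (mod int p)" (is ?second)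
proof -
  let ?M = "gen_motzkin a b" and ?L = "\<lambda>n. trin_coeff a b n 1"
  have idx: "Suc (p - 1) = p" "Suc (p - 2) = p - 1" "int (p - 1) = int p - 1" "int (p - 2) = int p - 2"
    using \<open>p > 2\<close> by simp_all
  \<comment> \<open>This power is both the inverse of \<open>a\<close> modulo \<open>p\<close> and
    the top coefficient of \<open>P ^ (p - 2)\<close>. The witnesses \<open>k1\<close> to
    \<open>k4\<close> turn the congruences into integer identities.\<close>
  define c where "c = int a ^ (p - 2)"
  have "[int a * c = 1] (mod int p)"
  proof -
    have "\<not> int p dvd int a" using a by (simp only: int_dvd_int_iff not_False_eq_True)
    from fermat_inverse[OF p this] show ?thesis by (simp add: c_def)
  qed
  then obtain k1 where k1: "int a * c = 1 + int p * k1"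
    by (metis cong_iff_lin cong_sym)
  have "[T (p * 1 + 0) = T 1 * T 0] (mod int p)"
    unfolding T_def using p \<open>p > 2\<close> by (intro central_trinomial_lucas) simp_all
  then have "[T p = int b] (mod int p)"
    by (simp add: T_def central_trinomial_0 central_trinomial_1)
  then obtain k2 where k2: "T p = int b + int p * k2"
    by (metis cong_iff_lin cong_sym)
  have Tp: "T p = int b * T (p - 1) + 2 * int a * ?L (p - 1)"
    using central_trinomial_Suc[of a b "p - 1"] by (simp only: T_def idx)
  have Lp1: "?L (p - 1) = (int p - 1) * int a * ?M (p - 2)"
    using trin_coeff_Suc_1[of a b "p - 2"] by (simp only: idx)
  have Lp: "?L p = int p * int a * ?M (p - 1)"
    using trin_coeff_Suc_1[of a b "p - 1"] by (simp only: idx)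
  have Mp1: "int a * ?M (p - 1) = int b * ?L (p - 1) + 2 * int a * T (p - 1) - ?L p"
    using gen_motzkin_via_trin_coeff[of a b "p - 1"] by (simp only: idx T_def)
  have Ln: "2 * int a * ?L n = T (n + 1) - int b * T n"
    using central_trinomial_Suc[of a b n] by (simp add: T_def)
  have "[?M (p * n + (p - 2)) = T n * ?M (p - 2) - ?L n * trin_coeff a b (p - 2) (int p - 2)]
      (mod int p)"
    unfolding T_def using p \<open>p > 2\<close> by (intro gen_motzkin_lucas) simp_all
  moreover have "trin_coeff a b (p - 2) (int p - 2) = c"
    using trin_coeff_top[of a b "p - 2"] by (simp only: idx c_def)
  ultimately obtain k3 where k3: "?M (p * n + (p - 2)) = T n * ?M (p - 2) - ?L n * c + int p * k3"
    by (metis cong_iff_lin cong_sym)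
  have "[?M (p * n + (p - 1)) = T n * ?M (p - 1) - ?L n * trin_coeff a b (p - 1) (int p - 2)]
      (mod int p)"
    unfolding T_def using p \<open>p > 2\<close> by (intro gen_motzkin_lucas) simp_all
  moreover have "trin_coeff a b (p - 1) (int p - 2) = (int p - 1) * c * int b"
    using trin_coeff_subtop[of a b "p - 2"] by (simp only: idx c_def)
  ultimately obtain k4 where k4: "?M (p * n + (p - 1)) =
      T n * ?M (p - 1) - ?L n * ((int p - 1) * c * int b) + int p * k4"
    by (metis cong_iff_lin cong_sym)
  \<comment> \<open>The factor \<open>2 * a ^ 2\<close> serves two purposes: \<open>L\<close> is
    known through \<open>T\<close> only as \<open>2 * a * L\<close>, and the other \<open>a\<close>
    cancels \<open>c\<close>.\<close>
  have M2: "2 * (int a)\<^sup>2 * ?M (p - 2) =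
      int b * T (p - 1) - int b + int p * (2 * (int a)\<^sup>2 * ?M (p - 2) - k2)"
  proof -
    have "2 * int a * ?L (p - 1) = int p * (2 * (int a)\<^sup>2 * ?M (p - 2)) - 2 * (int a)\<^sup>2 * ?M (p - 2)"
      unfolding Lp1 by (simp add: algebra_simps power2_eq_square)
    then show ?thesis
      using k2 Tp unfolding right_diff_distrib by linarith
  qed
  have M1: "2 * (int a)\<^sup>2 * ?M (p - 1) =
      (int b)\<^sup>2 - \<Delta> * T (p - 1) + int p * (int b * k2 - 2 * (int a)\<^sup>2 * ?M (p - 1))"
  proof -
    have "2 * (int a)\<^sup>2 * ?M (p - 1) = 2 * int a * (int a * ?M (p - 1))"
      by (simp add: power2_eq_square)
    also have "\<dots> = int b * (2 * int a * ?L (p - 1)) + 4 * (int a)\<^sup>2 * T (p - 1) - 2 * int a * ?L p"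
      unfolding Mp1 by (simp add: algebra_simps power2_eq_square)
    also have "2 * int a * ?L (p - 1) = int b + int p * k2 - int b * T (p - 1)"
      using Tp k2 by simp
    finally show ?thesis
      unfolding Lp by (simp add: \<Delta>_def algebra_simps power2_eq_square)
  qed
  have "2 * (int a)\<^sup>2 * ?M (p * n + (p - 2)) = T n * (2 * (int a)\<^sup>2 * ?M (p - 2))
      - (int a * c) * (2 * int a * ?L n) + int p * (2 * (int a)\<^sup>2 * k3)"
    unfolding k3 by (simp add: algebra_simps power2_eq_square)
  also have "\<dots> = T n * (int b * T (p - 1) - int b + int p * (2 * (int a)\<^sup>2 * ?M (p - 2) - k2))
      - (1 + int p * k1) * (T (n + 1) - int b * T n) + int p * (2 * (int a)\<^sup>2 * k3)"
    by (simp only: M2[symmetric] k1 Ln)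
  also have "\<dots> = (int b * T (p - 1) * T n - T (n + 1)) + int p * (
      T n * (2 * (int a)\<^sup>2 * ?M (p - 2) - k2) - k1 * (T (n + 1) - int b * T n) + 2 * (int a)\<^sup>2 * k3)"
    by (simp add: algebra_simps)
  finally show ?first
    by (metis cong_iff_lin cong_sym)
  have "2 * (int a)\<^sup>2 * ?M (p * n + (p - 1)) = T n * (2 * (int a)\<^sup>2 * ?M (p - 1))
      - (int p - 1) * int b * ((int a * c) * (2 * int a * ?L n)) + int p * (2 * (int a)\<^sup>2 * k4)"
    unfolding k4 by (simp add: algebra_simps power2_eq_square)
  also have "\<dots> = T n * ((int b)\<^sup>2 - \<Delta> * T (p - 1)
        + int p * (int b * k2 - 2 * (int a)\<^sup>2 * ?M (p - 1)))
      - (int p - 1) * int b * ((1 + int p * k1) * (T (n + 1) - int b * T n))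
      + int p * (2 * (int a)\<^sup>2 * k4)"
    by (simp only: M1[symmetric] k1 Ln)
  also have "\<dots> = (int b * T (n + 1) - \<Delta> * T (p - 1) * T n) + int p * (
      T n * (int b * k2 - 2 * (int a)\<^sup>2 * ?M (p - 1))
      - int b * (1 + int p * k1) * (T (n + 1) - int b * T n)
      + int b * k1 * (T (n + 1) - int b * T n) + 2 * (int a)\<^sup>2 * k4)"
    by (simp add: algebra_simps power2_eq_square)
  finally show ?second
    by (metis cong_iff_lin cong_sym)
qed

text \<open>By the Lucas congruence for \<open>M\<close> it suffices that \<open>T\<close> and
  \<open>L\<close> both vanish modulo \<open>p\<close> outside density 0. Treating \<open>L\<close>
  directly avoids dividing by \<open>2 * a\<close>, so \<open>p = 2\<close> and
  \<open>p dvd a\<close> are covered.\<close>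

lemma density_gen_motzkin_nonzero:
  fixes a b p :: nat
  assumes p: "prime p" and "m < p" "int p dvd central_trinomial a b m"
  shows "has_asymptotic_density {n. \<not> int p dvd gen_motzkin a b n} 0"
proof -
  interpret lucas_sequence p "central_trinomial a b"
    using p by (rule lucas_sequence_central_trinomial)
  let ?T = "central_trinomial a b" and ?L = "\<lambda>n. trin_coeff a b n 1"
  have T: "has_asymptotic_density {n. \<not> int p dvd ?T n} 0"
    using assms(2,3) by (rule density_nonzero)
  define g :: "nat \<Rightarrow> real" where "g = (\<lambda>n. of_bool (\<not> int p dvd ?T n))"
  define f :: "nat \<Rightarrow> real" where "f = (\<lambda>n. of_bool (int p dvd ?T n \<and> \<not> int p dvd ?L n))"
  \<comment> \<open>Where \<open>T n\<close> vanishes, only the last digit can keep \<open>L\<close>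
    nonzero, leaving one section out of \<open>p\<close>. The other blocks contribute at most
    \<open>p\<close> each, and their indices have density 0.\<close>
  have fg: "(\<Sum>m<p. f (p * n + m)) \<le> f n + real p * g n" for n
  proof (cases "int p dvd ?T n")
    case False
    have "(\<Sum>m<p. f (p * n + m)) \<le> (\<Sum>m<p. 1)" by (intro sum_mono) (simp add: f_def)
    also have "\<dots> \<le> f n + real p * g n" using False by (simp add: f_def g_def)
    finally show ?thesis .
  next
    case True
    have L: "int p dvd ?L (p * n + m) \<longleftrightarrow> int p dvd ?L n * trin_coeff a b m (int p - 1)" if "m < p" for m
      using cong_dvd_iff[OF trin_coeff_1_lucas[OF p that, of a b n]] True
      by (simp add: dvd_add_right_iff)
    have "f (p * n + m) = 0" if "m < p - 1" for m
      using that L[of m] by (simp add: f_def trin_coeff_outside)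
    moreover have "f (p * n + (p - 1)) \<le> f n"
      using True L[of "p - 1"] p_ge_2 by (auto simp: f_def)
    moreover have "(\<Sum>m<p. f (p * n + m)) = (\<Sum>m<p - 1. f (p * n + m)) + f (p * n + (p - 1))"
      using p_ge_2 by (cases p) simp_all
    ultimately show ?thesis by (simp add: g_def)
  qed
  have "mean_zero f"
  proof (rule mean_zero_contraction[where I = "{()}" and f = "\<lambda>_. f" and J = "\<lambda>_. {()}" and q = p
      and e = "\<lambda>_ N. real p * (\<Sum>n<N. g n)" and B = 1])
    fix N
    have "(\<Sum>n<p * N. f n) = (\<Sum>n<N. \<Sum>m<p. f (p * n + m))"
      unfolding sum_lessThan_mult by (rule sum.swap)
    also have "\<dots> \<le> (\<Sum>n<N. f n + real p * g n)"
      by (intro sum_mono fg)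
    also have "\<dots> = (\<Sum>n<N. f n) + real p * (\<Sum>n<N. g n)"
      by (simp add: sum.distrib sum_distrib_left)
    finally show "\<bar>\<Sum>n<p * N. f n\<bar> \<le> (\<Sum>j\<in>{()}. \<bar>\<Sum>n<N. f n\<bar>) + real p * (\<Sum>n<N. g n)"
      by (simp add: f_def sum_nonneg)
  next
    have "(\<lambda>N. real p * ((\<Sum>n<N. g n) / real N)) \<longlonglongrightarrow> real p * 0"
      using T unfolding has_asymptotic_density_iff_mean_zero mean_zero_def g_def
      by (intro tendsto_mult tendsto_const) simp
    then show "(\<lambda>N. real p * (\<Sum>n<N. g n) / real N) \<longlonglongrightarrow> 0" by simp
  qed (use p_ge_2 in \<open>auto simp: f_def\<close>)
  then have "has_asymptotic_density {n. int p dvd ?T n \<and> \<not> int p dvd ?L n} 0"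
    by (simp add: has_asymptotic_density_iff_mean_zero f_def)
  with T have L: "has_asymptotic_density {n. \<not> int p dvd ?L n} 0"
    by (rule has_asymptotic_density_0_subset_Un) auto
  have "has_asymptotic_density {n. \<not> int p dvd gen_motzkin a b n} ((\<Sum>m<p. 0) / real p)"
  proof (rule has_asymptotic_density_sections)
    fix m assume "m < p"
    show "has_asymptotic_density {n. p * n + m \<in> {n. \<not> int p dvd gen_motzkin a b n}} 0"
      using cong_dvd_iff[OF gen_motzkin_lucas[OF p \<open>m < p\<close>, of a b]]
      by (intro has_asymptotic_density_0_subset_Un[OF T L]) auto
  qed (use p_ge_2 in simp)
  then show ?thesis by simp
qed

text \<open>The digit \<open>p - 1\<close> of \<open>M\<close> leads to counts with the roles of
  \<open>T m\<close> and \<open>T (m + 1)\<close> exchanged. After multiplication by a power of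
  \<open>\<Delta>\<close>, reflection and cancellation of \<open>T (p - 1)\<close>, the map from
  \<open>m\<close> to \<open>p - 2 - m\<close> gives the sets in \<open>D0\<close>.\<close>

lemma card_reflect:
  fixes a b p :: nat and \<gamma> :: int
  assumes p: "prime p" and nz: "\<And>n. n < p \<Longrightarrow> \<not> int p dvd central_trinomial a b n"
  defines "T \<equiv> central_trinomial a b" and "\<Delta> \<equiv> (int b)\<^sup>2 - 4 * (int a)\<^sup>2"
  assumes \<Delta>: "\<not> int p dvd \<Delta>"
  shows "card {m. m < p - 1 \<and> [int b * T (m + 1) = \<gamma> * \<Delta> * T m] (mod int p)} =
    card {m. m < p - 1 \<and> [int b * T m = \<gamma> * T (m + 1)] (mod int p)}"
proof (rule bij_betw_same_card[of "\<lambda>m. p - 2 - m"])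
  have iff: "[int b * T (m + 1) = \<gamma> * \<Delta> * T m] (mod int p) \<longleftrightarrow>
      [int b * T m' = \<gamma> * T (m' + 1)] (mod int p)" if m: "p = m + m' + 2" for m m'
  proof -
    have cancel: "[z * x = z * y] (mod int p) \<longleftrightarrow> [x = y] (mod int p)" if "\<not> int p dvd z" for x y z
      using p that by (simp add: cong_iff_dvd_diff prime_dvd_mult_iff flip: right_diff_distrib)
    have "\<not> int p dvd \<Delta> ^ m'" using p \<Delta> by (auto dest: prime_dvd_power[rotated])
    then have "[int b * T (m + 1) = \<gamma> * \<Delta> * T m] (mod int p) \<longleftrightarrow>
        [\<Delta> ^ m' * (int b * T (m + 1)) = \<Delta> ^ m' * (\<gamma> * \<Delta> * T m)] (mod int p)"
      by (rule cancel[symmetric])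
    also have "\<dots> \<longleftrightarrow> [T (p - 1) * (int b * T m') = T (p - 1) * (\<gamma> * T (m' + 1))] (mod int p)"
    proof -
      have "[\<Delta> ^ m' * T (m + 1) = T (p - 1) * T m'] (mod int p)"
        "[\<Delta> ^ (m' + 1) * T m = T (p - 1) * T (m' + 1)] (mod int p)"
        using central_trinomial_reflect[OF p, where m = m' and a = a and b = b]
          central_trinomial_reflect[OF p, where m = "m' + 1" and a = a and b = b]
        by (simp_all add: m T_def \<Delta>_def)
      from cong_scalar_left[OF this(1), of "int b"] cong_scalar_left[OF this(2), of \<gamma>]
      have "[\<Delta> ^ m' * (int b * T (m + 1)) = T (p - 1) * (int b * T m')] (mod int p)"
        "[\<Delta> ^ m' * (\<gamma> * \<Delta> * T m) = T (p - 1) * (\<gamma> * T (m' + 1))] (mod int p)"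
        by (simp_all add: algebra_simps)
      then show ?thesis by (metis cong_sym cong_trans)
    qed
    also have "\<dots> \<longleftrightarrow> [int b * T m' = \<gamma> * T (m' + 1)] (mod int p)"
      using nz[of "p - 1"] prime_gt_0_nat[OF p] by (intro cancel) (simp add: T_def)
    finally show ?thesis .
  qed
  show "bij_betw (\<lambda>m. p - 2 - m) {m. m < p - 1 \<and> [int b * T (m + 1) = \<gamma> * \<Delta> * T m] (mod int p)}
      {m. m < p - 1 \<and> [int b * T m = \<gamma> * T (m + 1)] (mod int p)}"
  proof (rule bij_betw_byWitness[where f' = "\<lambda>m. p - 2 - m"])
    show "(\<lambda>m. p - 2 - m) ` {m. m < p - 1 \<and> [int b * T (m + 1) = \<gamma> * \<Delta> * T m] (mod int p)}
        \<subseteq> {m. m < p - 1 \<and> [int b * T m = \<gamma> * T (m + 1)] (mod int p)}"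
    proof (clarify, intro conjI)
      fix m assume m: "m < p - 1" "[int b * T (m + 1) = \<gamma> * \<Delta> * T m] (mod int p)"
      then show "p - 2 - m < p - 1" by simp
      show "[int b * T (p - 2 - m) = \<gamma> * T (p - 2 - m + 1)] (mod int p)"
        using m iff[of m "p - 2 - m"] by simp
    qed
    show "(\<lambda>m. p - 2 - m) ` {m. m < p - 1 \<and> [int b * T m = \<gamma> * T (m + 1)] (mod int p)}
        \<subseteq> {m. m < p - 1 \<and> [int b * T (m + 1) = \<gamma> * \<Delta> * T m] (mod int p)}"
    proof (clarify, intro conjI)
      fix m assume m: "m < p - 1" "[int b * T m = \<gamma> * T (m + 1)] (mod int p)"
      then show "p - 2 - m < p - 1" by simp
      show "[int b * T (p - 2 - m + 1) = \<gamma> * \<Delta> * T (p - 2 - m)] (mod int p)"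
        using m iff[of "p - 2 - m" m] by simp
    qed
  qed auto
qed

text \<open>The second part excludes \<open>p dvd a\<close>: there \<open>T\<close> and
  \<open>M\<close> are both congruent to \<open>b ^ n\<close>, so for \<open>b\<close> prime to
  \<open>p\<close> zero never occurs although \<open>D0\<close> is \<open>2 / p\<close> for odd
  \<open>p\<close>.\<close>

theorem proposition12:
  fixes a b p :: nat
  assumes "prime p"
  shows "((\<exists>n<p. [central_trinomial a b n = 0] (mod int p)) \<longrightarrow>
            value_density_mod (gen_motzkin a b) p 0 1) \<and>
         ((\<forall>n<p. \<not> [central_trinomial a b n = 0] (mod int p)) \<and> p > 2 \<and> \<not> p dvd a \<longrightarrow>
            value_density_mod (gen_motzkin a b) p 0 (D0 a b p) \<and>
            (generate (units_of (residue_ring (int p)))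
                 ((\<lambda>n. central_trinomial a b n mod int p) ` {n. n \<le> p - 1})
               = carrier (units_of (residue_ring (int p))) \<longrightarrow>
             (\<forall>k \<in> carrier (residue_ring (int p)). k \<noteq> 0 \<longrightarrow>
                value_density_mod (gen_motzkin a b) p k ((1 - D0 a b p) / (real p - 1)))))"
proof (rule conjI; rule impI)
  assume "\<exists>n<p. [central_trinomial a b n = 0] (mod int p)"
  then obtain m where "m < p" "int p dvd central_trinomial a b m"
    by (auto simp: cong_0_iff)
  then have "has_asymptotic_density {n. \<not> int p dvd gen_motzkin a b n} 0"
    using assms by (intro density_gen_motzkin_nonzero)
  from has_asymptotic_density_compl[OF this]
  show "value_density_mod (gen_motzkin a b) p 0 1"
    by (simp add: value_density_mod_def Compl_eq dvd_eq_mod_eq_0)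
next
  let ?T = "central_trinomial a b" and ?M = "gen_motzkin a b"
  assume "(\<forall>n<p. \<not> [?T n = 0] (mod int p)) \<and> p > 2 \<and> \<not> p dvd a"
  then have nz: "\<And>n. n < p \<Longrightarrow> \<not> int p dvd ?T n" and "p > 2" and a: "\<not> p dvd a"
    by (simp_all add: cong_0_iff)
  interpret lucas_sequence p ?T
    using assms by (rule lucas_sequence_central_trinomial)
  interpret nonvanishing_lucas_sequence p ?T
    using nz by unfold_locales
  define t where "t = ?T (p - 1)"
  define \<Delta> where "\<Delta> = (int b)\<^sup>2 - 4 * (int a)\<^sup>2"
  \<comment> \<open>Reflection at \<open>m = p - 1\<close>. As \<open>t\<close> is nonzero modulo
    \<open>p\<close>, so is \<open>\<Delta>\<close>, and Fermat's theorem then gives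
    \<open>t ^ 2 = 1\<close> modulo \<open>p\<close>.\<close>
  have reflect: "[\<Delta> ^ (p - 1) = t * t] (mod int p)"
    using central_trinomial_reflect[OF assms, where m = "p - 1" and a = a and b = b] \<open>p > 2\<close>
    by (simp add: \<Delta>_def t_def central_trinomial_0)
  have \<Delta>: "\<not> int p dvd \<Delta>"
  proof
    assume "int p dvd \<Delta>"
    then have "int p dvd \<Delta> ^ (p - 1)" using \<open>p > 2\<close> by (auto intro: dvd_trans[OF _ dvd_power])
    then have "int p dvd t * t" using reflect by (simp add: cong_dvd_iff)
    then show False using not_dvd_prod[OF nonvanishing nonvanishing] by (simp add: t_def)
  qed
  have t2: "[t * t = 1] (mod int p)"
    using fermat_int[OF assms \<Delta>] reflect by (metis cong_sym cong_trans)
  define A where "A = card {m. m < p - 1 \<and> [int b * ?T m = t * ?T (m + 1)] (mod int p)}"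
  define B where "B = card {m. m < p - 1 \<and> [int b * ?T m = ?T (m + 1)] (mod int p)}"
  define d where "d = (real p * real A + real B) / ((real p - 1) * (real p + 1))"
  have two_a: "\<not> int p dvd 2 * (int a)\<^sup>2"
  proof -
    have "\<not> int p dvd 2" using \<open>p > 2\<close> by (auto dest: zdvd_imp_le)
    moreover have "\<not> int p dvd int a" using a by (simp only: int_dvd_int_iff not_False_eq_True)
    ultimately show ?thesis unfolding power2_eq_square by (intro not_dvd_prod)
  qed
  define s where "s = (2 * (int a)\<^sup>2) ^ (p - 2)"
  have s: "[s * (2 * (int a)\<^sup>2) = 1] (mod int p)"
    using fermat_inverse[OF assms two_a] by (simp add: s_def mult.commute)
  have s_dvd: "int p dvd s * x \<longleftrightarrow> int p dvd x" for x
  proof -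
    have "\<not> int p dvd s"
      unfolding s_def using two_a by (rule not_dvd_power)
    then show ?thesis using assms by (simp add: prime_dvd_mult_iff)
  qed
  have t_dvd: "int p dvd t * x \<longleftrightarrow> int p dvd x" for x
    using assms nonvanishing[of "p - 1"] by (simp add: t_def prime_dvd_mult_iff)
  have mult_s: "[x = s * y] (mod int p)" if "[2 * (int a)\<^sup>2 * x = y] (mod int p)" for x y
  proof -
    have "[1 * x = s * (2 * (int a)\<^sup>2) * x] (mod int p)"
      using s by (intro cong_mult cong_refl) (rule cong_sym)
    also have "[s * (2 * (int a)\<^sup>2) * x = s * y] (mod int p)"
      unfolding mult.assoc[of s] using that by (intro cong_mult cong_refl)
    finally show ?thesis by simp
  qed
  have main: "has_asymptotic_density {n. [?M n = k] (mod int p)} (equi_density k (D0 a b p))"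
    if k: "int p dvd k \<or> value_set = {1..int p - 1}" for k
  proof -
    \<comment> \<open>The zero density of each section: 0 or 1 for the digits below
      \<open>p - 2\<close>, and the same \<open>d\<close> for both remaining digits, whence the
      factor 2 in \<open>D0\<close>.\<close>
    define x where "x = (\<lambda>m. if m < p - 2 then of_bool (int p dvd ?M m) else d)"
    have "has_asymptotic_density {n. [?M n = k] (mod int p)}
        ((\<Sum>m<p. equi_density k (x m)) / real p)"
    proof (rule has_asymptotic_density_sections)
      fix m assume "m < p"
      have transfer: "{n. p * n + m \<in> {n. [?M n = k] (mod int p)}} = {n. [u n = k] (mod int p)}"
        if "\<And>n. [?M (p * n + m) = u n] (mod int p)" for u
        using that by (auto intro: cong_trans cong_sym)
      consider "m < p - 2" | "m = p - 2" | "m = p - 1" using \<open>m < p\<close> by linarith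
      then show "has_asymptotic_density {n. p * n + m \<in> {n. [?M n = k] (mod int p)}}
          (equi_density k (x m))"
      proof cases
        case 1
        have "[?M (p * n + m) = ?T n * ?M m] (mod int p)" for n
          using gen_motzkin_lucas[OF assms \<open>m < p\<close>, of a b n] 1 by (simp add: trin_coeff_outside)
        from transfer[OF this] show ?thesis
          using density_multiple[OF k, of "?M m"] 1 by (simp add: x_def)
      next
        case 2
        have "[?M (p * n + m) = s * int b * t * ?T n + - s * ?T (n + 1)] (mod int p)" for n
          using mult_s[OF gen_motzkin_last_digits(1)[OF assms \<open>p > 2\<close> a, where n = n and b = b]]
          by (simp add: 2 t_def algebra_simps)
        note transfer[OF this]
        moreover have "int p dvd s * int b * t * ?T m + - s * ?T (m + 1) \<longleftrightarrow>
            [int b * ?T m = t * ?T (m + 1)] (mod int p)" for m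
        proof -
          have "int p dvd s * int b * t * ?T m + - s * ?T (m + 1) \<longleftrightarrow>
              int p dvd s * (int b * ?T m * t - ?T (m + 1))"
            by (simp add: algebra_simps)
          also have "\<dots> \<longleftrightarrow> [int b * ?T m * t = ?T (m + 1)] (mod int p)"
            unfolding s_dvd by (simp add: cong_iff_dvd_diff)
          also have "\<dots> \<longleftrightarrow> [int b * ?T m = t * ?T (m + 1)] (mod int p)"
            \<comment> \<open>Modulo \<open>p\<close>, \<open>t\<close> is its own inverse and may
              change sides.\<close>
            by (subst mult.commute[of t]) (rule cong_mult_inverse_iff[OF t2])
          finally show ?thesis .
        qed
        moreover have "int p dvd s * int b * t * t * ?T m + - s * ?T (m + 1) \<longleftrightarrow>
            [int b * ?T m = ?T (m + 1)] (mod int p)" for m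
        proof -
          have "[s * (int b * ?T m) * (t * t) - s * ?T (m + 1) =
              s * (int b * ?T m) * 1 - s * ?T (m + 1)] (mod int p)"
            by (intro cong_diff cong_mult cong_refl t2)
          then have "int p dvd s * int b * t * t * ?T m + - s * ?T (m + 1) \<longleftrightarrow>
              int p dvd s * (int b * ?T m - ?T (m + 1))"
            by (simp add: cong_dvd_iff algebra_simps)
          then show ?thesis unfolding s_dvd by (simp add: cong_iff_dvd_diff)
        qed
        ultimately show ?thesis
          using density_consecutive[OF k t2[unfolded t_def], of "s * int b * t" "- s"] 2
          by (simp add: x_def d_def A_def B_def t_def)
      next
        case 3
        have "[?M (p * n + m) = - s * \<Delta> * t * ?T n + s * int b * ?T (n + 1)] (mod int p)" for n
          using mult_s[OF gen_motzkin_last_digits(2)[OF assms \<open>p > 2\<close> a, where n = n and b = b]]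
          by (simp add: 3 t_def \<Delta>_def algebra_simps)
        note transfer[OF this]
        moreover have "int p dvd - s * \<Delta> * t * ?T m + s * int b * ?T (m + 1) \<longleftrightarrow>
            [int b * ?T (m + 1) = t * \<Delta> * ?T m] (mod int p)" for m
        proof -
          have "int p dvd - s * \<Delta> * t * ?T m + s * int b * ?T (m + 1) \<longleftrightarrow>
              int p dvd s * (int b * ?T (m + 1) - t * \<Delta> * ?T m)"
            by (simp add: algebra_simps)
          then show ?thesis unfolding s_dvd by (simp add: cong_iff_dvd_diff)
        qed
        moreover have "int p dvd - s * \<Delta> * t * t * ?T m + s * int b * ?T (m + 1) \<longleftrightarrow>
            [int b * ?T (m + 1) = 1 * \<Delta> * ?T m] (mod int p)" for m
        proof -
          have "[s * int b * ?T (m + 1) - s * \<Delta> * ?T m * (t * t) =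
              s * int b * ?T (m + 1) - s * \<Delta> * ?T m * 1] (mod int p)"
            by (intro cong_diff cong_mult cong_refl t2)
          then have "int p dvd - s * \<Delta> * t * t * ?T m + s * int b * ?T (m + 1) \<longleftrightarrow>
              int p dvd s * (int b * ?T (m + 1) - \<Delta> * ?T m)"
            by (simp add: cong_dvd_iff algebra_simps)
          then show ?thesis unfolding s_dvd by (simp add: cong_iff_dvd_diff)
        qed
        \<comment> \<open>Reflection with \<open>\<gamma> = t\<close> and
          \<open>\<gamma> = 1\<close> identifies the counts for the digit \<open>p - 1\<close> with
          those for \<open>p - 2\<close>.\<close>
        moreover have "card {m. m < p - 1 \<and> [int b * ?T (m + 1) = t * \<Delta> * ?T m] (mod int p)} = A"
          "card {m. m < p - 1 \<and> [int b * ?T (m + 1) = 1 * \<Delta> * ?T m] (mod int p)} = B"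
          using card_reflect[OF assms nz \<Delta>[unfolded \<Delta>_def], of t]
            card_reflect[OF assms nz \<Delta>[unfolded \<Delta>_def], of 1]
          by (simp_all add: A_def B_def \<Delta>_def)
        moreover have "x m = d" using 3 by (simp add: x_def)
        ultimately show ?thesis
          using density_consecutive[OF k t2[unfolded t_def], of "- s * \<Delta> * t" "s * int b"]
          by (simp add: d_def t_def)
      qed
    qed (use \<open>p > 2\<close> in simp)
    also have "(\<Sum>m<p. equi_density k (x m)) / real p = equi_density k (D0 a b p)"
    proof -
      have "{..<p} = {..<p - 2} \<union> {p - 2, p - 1}" using \<open>p > 2\<close> by auto
      then have "(\<Sum>m<p. x m) = (\<Sum>m<p - 2. x m) + 2 * d"
        using \<open>p > 2\<close> by (simp only:) (subst sum.union_disjoint, auto simp: x_def)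
      also have "(\<Sum>m<p - 2. x m) = real (card {n. n < p - 2 \<and> [?M n = 0] (mod int p)})"
        by (simp add: x_def of_bool_def sum.If_cases lessThan_def Int_def cong_0_iff)
      finally have sum: "(\<Sum>m<p. x m) =
          real (card {n. n < p - 2 \<and> [?M n = 0] (mod int p)}) + 2 * d" .
      have "2 * d / real p =
          2 * real A / ((real p - 1) * (real p + 1)) + 2 * real B / ((real p - 1) * real p * (real p + 1))"
        using \<open>p > 2\<close> by (simp add: d_def divide_simps)
      then have "(\<Sum>m<p. x m) / real p = D0 a b p"
        unfolding sum add_divide_distrib D0_def by (simp add: A_def B_def t_def)
      then have "(\<Sum>m<p. x m) = real p * D0 a b p"
        using \<open>p > 2\<close> by (simp add: field_simps)
      then show ?thesis
        using \<open>p > 2\<close> unfolding sum_equi_density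
        by (simp add: equi_density_def flip: right_diff_distrib' times_divide_eq_right) (simp add: field_simps)
    qed
    finally show ?thesis .
  qed
  have "value_density_mod ?M p 0 (D0 a b p)"
    using main[of 0] by (simp add: value_density_mod_def equi_density_def cong_def)
  moreover have "value_density_mod ?M p k ((1 - D0 a b p) / (real p - 1))"
    if gen: "generate (units_of (residue_ring (int p))) ((\<lambda>n. ?T n mod int p) ` {n. n \<le> p - 1})
        = carrier (units_of (residue_ring (int p)))"
      and k: "k \<in> carrier (residue_ring (int p))" "k \<noteq> 0" for k
  proof -
    have k': "0 < k" "k < int p" using k by (auto simp: residue_ring_def)
    then have "\<not> int p dvd k" by (auto dest: zdvd_imp_le)
    then show ?thesis
      using main[of k] value_set_generated[OF gen] k'
      by (simp add: value_density_mod_def equi_density_def cong_def)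
  qed
  ultimately show "value_density_mod ?M p 0 (D0 a b p) \<and>
      (generate (units_of (residue_ring (int p))) ((\<lambda>n. ?T n mod int p) ` {n. n \<le> p - 1})
        = carrier (units_of (residue_ring (int p))) \<longrightarrow>
       (\<forall>k \<in> carrier (residue_ring (int p)). k \<noteq> 0 \<longrightarrow>
          value_density_mod ?M p k ((1 - D0 a b p) / (real p - 1))))"
    by blast
qed

end
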